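(* Let $k \geq 3$ be an integer. There exists a bijection $\varphi : SP_{k-1} \rightarrow IS_k$ such that $\overrightarrow{fr}(\varphi(f)) = \overrightarrow{fix}(f)$ for all $f \in SP_{k-1}$.
   Context: For a positive integer $n$, $[n]=\{1,\dots,n\}$. A surjective pistol of height $n$ is a surjective map $f:[2n]\to\{2,4,\dots,2n\}$ with $f(j)\ge j$ for all $j\in[2n]$; $SP_n$ denotes the set of them. For $f\in SP_{k-1}$, $\overrightarrow{fix}(f)=(t_1,\dots,t_{k-2})\in\{0,1\}^{k-2}$ where $t_i=1$ iff $f(2i)=2i$. A partition $\lambda=(\lambda_1\ge\dots\ge\lambda_m)$ (possibly empty) is drawn as its Ferrers diagram in French convention: left-justified rows, the $i$-th row from bottom to top having $\lambda_i$ cells. The hook length of a cell $c$ is the number of cells in its row weakly to its right (including $c$) plus the number of cells strictly above it in its column. For a positive integer $k$, the $k$-boundary $\partial^k(\lambda)$ is the set of cells of $\lambda$ of hook length at most $k$ (a skew diagram); its $k$-rim is the lower border of $\partial^k(\lambda)$. $rs^k(\lambda)$ (resp. $cs^k(\lambda)$) is the sequence of lengths of the rows of $\partial^k(\lambda)$ from bottom to top (resp. heights of its columns from left to right). $\lambda$ is a $k$-shape if $rs^k(\lambda)$ and $cs^k(\lambda)$ are both partitions (weakly decreasing). For a $k$-shape $\lambda$ and positive integers $u,v$, $H_u(\lambda)$ (resp. $V_v(\lambda)$) is the set of cells of $\partial^k(\lambda)$ lying in a row of $\partial^k(\lambda)$ of length $u$ (resp. in a column of $\partial^k(\lambda)$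 of height $v$); $V_0(\lambda)=\emptyset$. The horizontal steps of the $k$-rim are the bottom edges of the lowest cells of the columns of $\partial^k(\lambda)$; a set $S$ of cells contains such a step if the corresponding lowest cell lies in $S$ (so the number of horizontal steps of the $k$-rim in $H_u(\lambda)\cap V_v(\lambda)$ is the number of columns of $\partial^k(\lambda)$ of height $v$ whose lowest cell lies in a row of $\partial^k(\lambda)$ of length $u$). An irreducible $k$-shape is a $k$-shape $\lambda$ such that for every $i\in[k]$, each of the sets $H_i(\lambda)\cap V_{k-i}(\lambda)$ and $H_i(\lambda)\cap V_{k+1-i}(\lambda)$ contains at most $i-1$ horizontal steps of the $k$-rim of $\lambda$. $IS_k$ denotes the set of irreducible $k$-shapes. For $k\ge3$ and $\lambda\in IS_k$, an integer $i\in[k-2]$ is a free $k$-site of $\lambda$ if $H_{k-i}(\lambda)\cap V_{i+1}(\lambda)=\emptyset$, and $\overrightarrow{fr}(\lambda)=(t_1,\dots,t_{k-2})$ with $t_i=1$ iff $i$ is a free $k$-site. *)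

theory Defs
  imports Main "HOL-Library.FuncSet"
begin

text \<open>Surjective pistols of height \<open>n\<close>; extensionality makes them literally maps on \<open>[2n]\<close>.\<close>

definition surj_pistols :: "nat \<Rightarrow> (nat \<Rightarrow> nat) set" where
  "surj_pistols n =
     {f \<in> {1..2*n} \<rightarrow>\<^sub>E (\<lambda>i. 2*i) ` {1..n}.
        f ` {1..2*n} = (\<lambda>i. 2*i) ` {1..n} \<and> (\<forall>j\<in>{1..2*n}. j \<le> f j)}"

text \<open>The vector \<open>(t\<^sub>1, \<dots>, t\<^bsub>k-2\<^esub>)\<close> of a pistol of height \<open>k - 1\<close>.\<close>

definition fix_vec :: "nat \<Rightarrow> (nat \<Rightarrow> nat) \<Rightarrow> nat list" where
  "fix_vec k f = map (\<lambda>i. if f (2*i) = 2*i then 1 else 0) [1..<k-1]"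

definition is_partition :: "nat list \<Rightarrow> bool" where
  "is_partition l \<longleftrightarrow> sorted_wrt (\<ge>) l \<and> 0 \<notin> set l"

text \<open>A cell is a pair (row, column), both counted from \<open>0\<close>, rows from bottom to top (French
  convention).\<close>

type_synonym cell = "nat \<times> nat"

definition diagram :: "nat list \<Rightarrow> cell set" where
  "diagram l = {(i, j). i < length l \<and> j < l ! i}"

definition hook_length :: "nat list \<Rightarrow> cell \<Rightarrow> nat" where
  "hook_length l = (\<lambda>(i, j). card {j'. j \<le> j' \<and> (i, j') \<in> diagram l}
                           + card {i'. i < i' \<and> (i', j) \<in> diagram l})"

definition k_boundary :: "nat \<Rightarrow> nat list \<Rightarrow> cell set" where
  "k_boundary k l = {c \<in> diagram l. hook_length l c \<le> k}"

definition row_len :: "nat \<Rightarrow> nat list \<Rightarrow> nat \<Rightarrow> nat" where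
  "row_len k l i = card {j. (i, j) \<in> k_boundary k l}"

definition col_ht :: "nat \<Rightarrow> nat list \<Rightarrow> nat \<Rightarrow> nat" where
  "col_ht k l j = card {i. (i, j) \<in> k_boundary k l}"

text \<open>As for any skew diagram, the sequences run over all rows and columns of \<open>l\<close>, so a row or
  column of \<open>l\<close> without cells in the \<open>k\<close>-boundary contributes a \<open>0\<close>.\<close>

definition row_seq :: "nat \<Rightarrow> nat list \<Rightarrow> nat list" where
  "row_seq k l = map (row_len k l) [0..<length l]"

definition col_seq :: "nat \<Rightarrow> nat list \<Rightarrow> nat list" where
  "col_seq k l = map (col_ht k l) [0..<(if l = [] then 0 else hd l)]"

definition k_shape :: "nat \<Rightarrow> nat list \<Rightarrow> bool" where
  "k_shape k l \<longleftrightarrow>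
     is_partition l \<and> sorted_wrt (\<ge>) (row_seq k l) \<and> sorted_wrt (\<ge>) (col_seq k l)"

text \<open>\<open>V_cells k l 0\<close> is empty, since a column containing a cell of the \<open>k\<close>-boundary has positive
  height.\<close>

definition H_cells :: "nat \<Rightarrow> nat list \<Rightarrow> nat \<Rightarrow> cell set" where
  "H_cells k l u = {(i, j) \<in> k_boundary k l. row_len k l i = u}"

definition V_cells :: "nat \<Rightarrow> nat list \<Rightarrow> nat \<Rightarrow> cell set" where
  "V_cells k l v = {(i, j) \<in> k_boundary k l. col_ht k l j = v}"

text \<open>A horizontal step of the \<open>k\<close>-rim is the bottom edge of the lowest cell of a column of the
  \<open>k\<close>-boundary and is represented by that cell.\<close>

definition h_steps :: "nat \<Rightarrow> nat list \<Rightarrow> cell set" where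
  "h_steps k l = {(i, j) \<in> k_boundary k l. \<forall>i'<i. (i', j) \<notin> k_boundary k l}"

definition irreducible_k_shapes :: "nat \<Rightarrow> nat list set" where
  "irreducible_k_shapes k =
     {l. k_shape k l \<and>
         (\<forall>i\<in>{1..k}.
            card (h_steps k l \<inter> (H_cells k l i \<inter> V_cells k l (k - i))) \<le> i - 1 \<and>
            card (h_steps k l \<inter> (H_cells k l i \<inter> V_cells k l (k + 1 - i))) \<le> i - 1)}"

definition free_site :: "nat \<Rightarrow> nat list \<Rightarrow> nat \<Rightarrow> bool" where
  "free_site k l i \<longleftrightarrow> H_cells k l (k - i) \<inter> V_cells k l (i + 1) = {}"

definition fr_vec :: "nat \<Rightarrow> nat list \<Rightarrow> nat list" where
  "fr_vec k l = map (\<lambda>i. if free_site k l i then 1 else 0) [1..<k-1]"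

end

theory Submission
  imports Defs "HOL-Library.Multiset" "HOL-Library.Disjoint_Sets"
begin

text \<open>
  Build a \<open>k\<close>-shape by adding rows at the bottom. The columns that still meet the \<open>k\<close>-boundary
  form a queue; grouped by height they occupy the cells of a cyclic word, and adding a row
  rotates the word by one cell: the highest columns are finished and replaced by new ones.
  When rows of length \<open>u\<close> begin, one column is added to the first cell; the word then has
  \<open>k + 1 - u\<close> cells, and at some moment, when the first cell is occupied, the first two cells are
  merged. Irreducibility says precisely that the word never makes a full turn between two such
  events, so an irreducible \<open>k\<close>-shape is a sequence of pairs of rotation amounts, and the site
  \<open>k - u\<close> is free iff the merge for \<open>u\<close> happens at once.

  Undone step by step, the number of ways to perform a merge, and to add a column and rotate,
  depends only on the number \<open>m\<close> of occupied cells. Surjective pistols obey the same recursion: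
  cut a pistol of height \<open>n\<close> before a position \<open>y\<close>, and let \<open>m\<close> be the number of values at least
  \<open>y\<close> that are taken before \<open>y\<close>, where \<open>2 * n\<close> always counts. Summed over all sets of \<open>m\<close> such
  values, the number of ways to complete the pistol changes at an odd position as under a merge
  and at an even one as under adding a column. So the two families have the same number of members
  for each prescribed vector.
\<close>

section \<open>Intervals, rotations and fibres\<close>

lemma upward_closed_eq_interval:
  fixes A :: "nat set"
  assumes "A \<subseteq> {..<x}" and up: "\<And>i j. i \<in> A \<Longrightarrow> i \<le> j \<Longrightarrow> j < x \<Longrightarrow> j \<in> A"
  shows "A = {x - card A..<x}"
proof (cases "A = {}")
  case False
  have "finite A"
    using assms(1) by (rule finite_subset) simp
  have "A = {Min A..<x}"
  proof
    show "A \<subseteq> {Min A..<x}"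
      using \<open>finite A\<close> assms(1) by auto
    show "{Min A..<x} \<subseteq> A"
      using up[OF Min_in[OF \<open>finite A\<close> False]] by auto
  qed
  moreover have "Min A < x"
    using Min_in[OF \<open>finite A\<close> False] assms(1) by auto
  ultimately show ?thesis
    by (metis card_atLeastLessThan diff_diff_cancel less_imp_le)
qed auto

lemma count_list_replicate: "count_list (replicate n x) y = (if x = y then n else 0)"
  by (induction n) auto

lemma mset_rotate: "mset (rotate n xs) = mset xs"
  by (metis append_take_drop_id mset_append rotate_drop_take union_commute)

lemma sum_list_rotate: "sum_list (rotate n d) = sum_list (d :: 'a :: comm_monoid_add list)"
  by (metis mset_rotate sum_mset_sum_list)

lemma count_list_rotate: "count_list (rotate n xs) x = count_list xs x"
  by (metis count_mset mset_rotate)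

lemma hd_rotate: "n < length xs \<Longrightarrow> hd (rotate n xs) = xs ! n"
  by (subst hd_rotate_conv_nth) auto

lemma sum_hd_rotate: "n \<le> length d \<Longrightarrow> (\<Sum>r<n. hd (rotate r d)) = sum_list (take n d)"
  by (induction n) (simp_all add: take_Suc_conv_app_nth hd_rotate)

lemma rotate_eq_iff:
  assumes "length r = length b" "x < length b"
  shows "rotate x r = b \<longleftrightarrow> r = rotate ((length b - x) mod length b) b"
proof -
  let ?y = "(length b - x) mod length b"
  have "(?y + x) mod length b = 0"
    unfolding mod_add_left_eq using assms(2) by simp
  then have "rotate ?y (rotate x r) = r" "rotate x (rotate ?y b) = b"
    using assms(1) by (simp_all add: rotate_rotate add.commute[of x])
  then show ?thesis
    by metis
qed

lemma card_rotate_fibre: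
  assumes "finite S" "\<And>s. s \<in> S \<Longrightarrow> length (g s) = length b" "I \<subseteq> {..<length b}"
    and "\<And>x. x \<in> I \<Longrightarrow> (length b - x) mod length b \<in> I"
  shows "card {(x, s). x \<in> I \<and> s \<in> S \<and> rotate x (g s) = b} = (\<Sum>x\<in>I. card {s \<in> S. g s = rotate x b})"
proof -
  let ?neg = "\<lambda>x. (length b - x) mod length b"
  have "rotate x (g s) = b \<longleftrightarrow> g s = rotate (?neg x) b" if "x \<in> I" "s \<in> S" for x s
    using that assms(2,3) by (intro rotate_eq_iff) auto
  then have "{(x, s). x \<in> I \<and> s \<in> S \<and> rotate x (g s) = b} =
      (SIGMA x:I. {s \<in> S. g s = rotate (?neg x) b})"
    by blast
  then have "card {(x, s). x \<in> I \<and> s \<in> S \<and> rotate x (g s) = b} =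
      (\<Sum>x\<in>I. card {s \<in> S. g s = rotate (?neg x) b})"
    using assms(1) finite_subset[OF assms(3)] by simp
  also have "\<dots> = (\<Sum>x\<in>I. card {s \<in> S. g s = rotate x b})"
  proof -
    have "?neg (?neg x) = x" if "x \<in> I" for x
      using that assms(3) by (cases "x = 0") auto
    then show ?thesis
      using assms(4) by (intro sum.reindex_bij_witness[of _ ?neg ?neg]) simp_all
  qed
  finally show ?thesis .
qed

definition rotation_sum :: "nat \<Rightarrow> nat list \<Rightarrow> nat" where
  "rotation_sum n d = (\<Sum>r<n. hd (rotate (Suc r) d))"

lemma rotation_sum_0 [simp]: "rotation_sum 0 d = 0"
  and rotation_sum_Suc: "rotation_sum (Suc n) d = rotation_sum n d + hd (rotate (Suc n) d)"
  by (simp_all add: rotation_sum_def)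

lemma rotation_sum_plus_hd_le:
  assumes "n < length d"
  shows "rotation_sum n d + hd d \<le> sum_list d"
proof -
  have "rotation_sum n d + hd d = (\<Sum>r<Suc n. hd (rotate r d))"
    unfolding rotation_sum_def sum.lessThan_Suc_shift by simp
  also have "\<dots> = sum_list (take (Suc n) d)"
    using assms by (intro sum_hd_rotate) simp
  also have "\<dots> \<le> sum_list (take (Suc n) d) + sum_list (drop (Suc n) d)"
    by simp
  also have "\<dots> = sum_list d"
    by (simp flip: sum_list_append)
  finally show ?thesis .
qed

lemma rotation_sum_mono: "m \<le> n \<Longrightarrow> rotation_sum m d \<le> rotation_sum n d"
  unfolding rotation_sum_def by (intro sum_mono2) auto

lemma sum_list_le_rotation_sum:
  assumes "length d \<le> n"
  shows "sum_list d \<le> rotation_sum n d"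
proof -
  have "rotation_sum (length d) d = (\<Sum>r<length d. hd (rotate r (rotate1 d)))"
    by (simp add: rotation_sum_def rotate1_rotate_swap)
  also have "\<dots> = sum_list (rotate 1 d)"
    using sum_hd_rotate[of "length d" "rotate1 d"] by simp
  finally show ?thesis
    using rotation_sum_mono[OF assms, of d] by (simp only: sum_list_rotate)
qed

lemma rotation_sum_strict_mono:
  assumes "m < n" "n < length d" "0 < d ! n"
  shows "rotation_sum m d < rotation_sum n d"
proof -
  obtain n' where n_eq: "n = Suc n'"
    using assms(1) by (cases n) auto
  have "0 < hd (rotate n d)"
    using assms by (simp add: hd_rotate)
  then show ?thesis
    using rotation_sum_mono[of m n' d] assms(1) by (simp add: n_eq rotation_sum_Suc)
qed

lemma rotation_sum_inject:
  assumes "m < length d" "0 < d ! m" "n < length d" "0 < d ! n"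
    and "rotation_sum m d = rotation_sum n d"
  shows "m = n"
  using assms rotation_sum_strict_mono[of m n d] rotation_sum_strict_mono[of n m d]
  by (cases m n rule: linorder_cases) auto

lemma ex_bij_betw_fibres:
  assumes "finite A" "finite B" "\<And>c. card {a \<in> A. g a = c} = card {b \<in> B. h b = c}"
  shows "\<exists>\<phi>. bij_betw \<phi> A B \<and> (\<forall>a\<in>A. h (\<phi> a) = g a)"
proof -
  have "\<exists>F. bij_betw F {a \<in> A. g a = c} {b \<in> B. h b = c}" for c
    using assms by (intro finite_same_card_bij) auto
  then obtain F where fibre_bij: "\<And>c. bij_betw (F c) {a \<in> A. g a = c} {b \<in> B. h b = c}"
    by metis
  let ?\<phi> = "\<lambda>a. F (g a) a"
  have "bij_betw ?\<phi> {a \<in> A. g a = c} {b \<in> B. h b = c}" for c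
    using fibre_bij[of c] by (subst bij_betw_cong[where g = "F c"]) auto
  then have "bij_betw ?\<phi> (\<Union>c. {a \<in> A. g a = c}) (\<Union>c. {b \<in> B. h b = c})"
    by (intro bij_betw_UNION_disjoint) (auto simp: disjoint_family_on_def)
  moreover have "(\<Union>c. {a \<in> A. g a = c}) = A" "(\<Union>c. {b \<in> B. h b = c}) = B"
    by auto
  moreover have "h (?\<phi> a) = g a" if "a \<in> A" for a
    using bij_betw_apply[OF fibre_bij[of "g a"], of a] that by simp
  ultimately show ?thesis
    by auto
qed

section \<open>The boundary, row by row\<close>

definition full_ht :: "nat list \<Rightarrow> nat \<Rightarrow> nat" where
  "full_ht l j = length (filter (\<lambda>x. j < x) l)"

definition bottom_row :: "nat \<Rightarrow> nat \<Rightarrow> nat list \<Rightarrow> nat set" where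
  "bottom_row k x l = {j. j < x \<and> x - j + full_ht l j \<le> k}"

text \<open>The length of the row of the \<open>k\<close>-boundary that contains the lowest boundary cell of
  column \<open>j\<close>, and \<open>0\<close> if the column has no such cell.\<close>

fun base_row_len :: "nat \<Rightarrow> nat list \<Rightarrow> nat \<Rightarrow> nat" where
  "base_row_len k [] j = 0"
| "base_row_len k (x # l) j =
     (if j \<in> bottom_row k x l then card (bottom_row k x l) else base_row_len k l j)"

definition step_count :: "nat \<Rightarrow> nat list \<Rightarrow> nat \<Rightarrow> nat \<Rightarrow> nat" where
  "step_count k l u v = card {j. base_row_len k l j = u \<and> col_ht k l j = v}"

lemma full_ht_Nil [simp]: "full_ht [] j = 0"
  and full_ht_Cons [simp]: "full_ht (x # l) j = (if j < x then 1 else 0) + full_ht l j"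
  by (auto simp: full_ht_def)

lemma full_ht_antimono: "j \<le> j' \<Longrightarrow> full_ht l j' \<le> full_ht l j"
  by (induction l) auto

lemma diagram_Nil [simp]: "diagram [] = {}"
  by (auto simp: diagram_def)

lemma diagram_Cons_0 [simp]: "(0, j) \<in> diagram (x # l) \<longleftrightarrow> j < x"
  and diagram_Cons_Suc [simp]: "(Suc i, j) \<in> diagram (x # l) \<longleftrightarrow> (i, j) \<in> diagram l"
  by (auto simp: diagram_def)

lemma card_diagram_column: "card {i. (i, j) \<in> diagram l} = full_ht l j"
  by (simp add: diagram_def full_ht_def length_filter_conv_card)

lemma hook_length_Cons_0: "hook_length (x # l) (0, j) = x - j + full_ht l j"
proof -
  have "{i'. 0 < i' \<and> (i', j) \<in> diagram (x # l)} = Suc ` {i. (i, j) \<in> diagram l}"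
    by (auto simp: image_iff gr0_conv_Suc)
  moreover have "{j'. j \<le> j' \<and> (0, j') \<in> diagram (x # l)} = {j..<x}"
    by auto
  ultimately show ?thesis
    by (simp add: hook_length_def card_image card_diagram_column)
qed

lemma hook_length_Cons_Suc: "hook_length (x # l) (Suc i, j) = hook_length l (i, j)"
proof -
  have "{i'. Suc i < i' \<and> (i', j) \<in> diagram (x # l)} = Suc ` {i'. i < i' \<and> (i', j) \<in> diagram l}"
    by (auto simp: image_iff Suc_less_eq2)
  then show ?thesis
    by (simp add: hook_length_def card_image)
qed

lemma k_boundary_Nil [simp]: "k_boundary k [] = {}"
  and k_boundary_Cons_0 [simp]: "(0, j) \<in> k_boundary k (x # l) \<longleftrightarrow> j \<in> bottom_row k x l"
  and k_boundary_Cons_Suc [simp]: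
    "(Suc i, j) \<in> k_boundary k (x # l) \<longleftrightarrow> (i, j) \<in> k_boundary k l"
  by (auto simp: k_boundary_def bottom_row_def hook_length_Cons_0 hook_length_Cons_Suc)

lemma row_len_Cons_0 [simp]: "row_len k (x # l) 0 = card (bottom_row k x l)"
  and row_len_Cons_Suc [simp]: "row_len k (x # l) (Suc i) = row_len k l i"
  by (simp_all add: row_len_def)

lemma row_seq_Nil [simp]: "row_seq k [] = []"
  and row_seq_Cons [simp]: "row_seq k (x # l) = card (bottom_row k x l) # row_seq k l"
  by (simp_all add: row_seq_def upt_conv_Cons flip: map_Suc_upt del: upt_Suc)

lemma bottom_row_subset: "bottom_row k x l \<subseteq> {..<x}"
  by (auto simp: bottom_row_def)

lemma finite_bottom_row [simp]: "finite (bottom_row k x l)"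
  by (rule finite_subset[OF bottom_row_subset]) simp

lemma finite_k_boundary_column: "finite {i. (i, j) \<in> k_boundary k l}"
  by (rule finite_subset[of _ "{..<length l}"]) (auto simp: k_boundary_def diagram_def)

lemma col_ht_Nil [simp]: "col_ht k [] j = 0"
  by (simp add: col_ht_def)

lemma col_ht_Cons [simp]:
  "col_ht k (x # l) j = (if j \<in> bottom_row k x l then 1 else 0) + col_ht k l j"
proof -
  have "{i. (i, j) \<in> k_boundary k (x # l)} =
        (if j \<in> bottom_row k x l then {0} else {}) \<union> Suc ` {i. (i, j) \<in> k_boundary k l}"
  proof (intro set_eqI)
    fix i
    show "i \<in> {i. (i, j) \<in> k_boundary k (x # l)} \<longleftrightarrow>
      i \<in> (if j \<in> bottom_row k x l then {0} else {}) \<union> Suc ` {i. (i, j) \<in> k_boundary k l}"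
      by (cases i) auto
  qed
  then show ?thesis
    by (auto simp: col_ht_def card_image finite_k_boundary_column card_insert_if)
qed

lemma col_ht_le_full_ht: "col_ht k l j \<le> full_ht l j"
  by (induction l) (auto simp: bottom_row_def)

lemma bottom_row_eq_interval: "bottom_row k x l = {x - card (bottom_row k x l)..<x}"
proof (rule upward_closed_eq_interval[OF bottom_row_subset])
  fix i j
  assume "i \<in> bottom_row k x l" "i \<le> j" "j < x"
  then show "j \<in> bottom_row k x l"
    using full_ht_antimono[of i j l] by (auto simp: bottom_row_def)
qed

lemma mem_bottom_row_iff:
  "j \<in> bottom_row k x l \<longleftrightarrow> j < x \<and> x \<le> j + card (bottom_row k x l)"
  by (subst bottom_row_eq_interval) auto

lemma card_bottom_row_le: "card (bottom_row k x l) \<le> x"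
  using card_mono[OF finite_lessThan bottom_row_subset, of k x l] by simp

lemma card_bottom_row_plus_full_ht_le:
  assumes "0 < card (bottom_row k x l)"
  shows "card (bottom_row k x l) + full_ht l (x - card (bottom_row k x l)) \<le> k"
proof -
  have "x - card (bottom_row k x l) \<in> bottom_row k x l"
    using assms card_bottom_row_le[of k x l] by (subst mem_bottom_row_iff) simp
  then show ?thesis
    using card_bottom_row_le[of k x l] by (simp add: bottom_row_def[of k x l])
qed

lemma less_Suc_card_bottom_row_plus_full_ht:
  assumes "card (bottom_row k x l) < x"
  shows "k < Suc (card (bottom_row k x l)) + full_ht l (x - Suc (card (bottom_row k x l)))"
proof -
  have "x - Suc (card (bottom_row k x l)) \<notin> bottom_row k x l"
    using assms by (subst mem_bottom_row_iff) simp
  then show ?thesis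
    using assms by (simp add: bottom_row_def[of k x l])
qed

lemma card_bottom_row_le_k: "card (bottom_row k x l) \<le> k"
  using card_bottom_row_plus_full_ht_le[of k x l] by linarith

lemma base_row_len_plus_col_ht_le: "base_row_len k l j + col_ht k l j \<le> k + 1"
proof (induction l)
  case (Cons x l)
  let ?c = "card (bottom_row k x l)"
  show ?case
  proof (cases "j \<in> bottom_row k x l")
    case True
    then have "0 < ?c" "x - ?c \<le> j"
      using mem_bottom_row_iff[of j k x l] by (auto simp: card_gt_0_iff)
    then have "?c + full_ht l j \<le> k"
      using card_bottom_row_plus_full_ht_le[of k x l] full_ht_antimono[of "x - ?c" j l] by linarith
    then show ?thesis
      using True col_ht_le_full_ht[of k l j] by simp
  qed (use Cons in simp)
qed simp

lemma step_count_Cons_shorter: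
  assumes "u < card (bottom_row k x l)" "k \<le> u + v"
  shows "step_count k (x # l) u v = step_count k l u v"
proof -
  have "\<not> (base_row_len k l j = u \<and> col_ht k l j = v)" if "j \<in> bottom_row k x l" for j
    using base_row_len_plus_col_ht_le[of k "x # l" j] that assms by auto
  then have "base_row_len k (x # l) j = u \<and> col_ht k (x # l) j = v \<longleftrightarrow>
             base_row_len k l j = u \<and> col_ht k l j = v" for j
    using assms by auto
  then show ?thesis
    by (simp only: step_count_def)
qed

lemma base_row_len_mem_row_seq: "base_row_len k l j \<noteq> 0 \<Longrightarrow> base_row_len k l j \<in> set (row_seq k l)"
  by (induction l) auto

lemma step_count_eq_0:
  assumes "u \<noteq> 0" "u \<notin> set (row_seq k l)"
  shows "step_count k l u v = 0"
proof -
  have "{j. base_row_len k l j = u \<and> col_ht k l j = v} = {}"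
    using base_row_len_mem_row_seq[of k l] assms by auto
  then show ?thesis
    by (simp only: step_count_def card.empty)
qed

lemma h_steps_Nil [simp]: "h_steps k [] = {}"
  and h_steps_Cons_0 [simp]: "(0, j) \<in> h_steps k (x # l) \<longleftrightarrow> j \<in> bottom_row k x l"
  and h_steps_Cons_Suc [simp]:
    "(Suc i, j) \<in> h_steps k (x # l) \<longleftrightarrow> j \<notin> bottom_row k x l \<and> (i, j) \<in> h_steps k l"
  by (auto simp: h_steps_def less_Suc_eq_0_disj)

lemma base_row_len_eq_iff:
  "u \<noteq> 0 \<Longrightarrow> base_row_len k l j = u \<longleftrightarrow> (\<exists>i. (i, j) \<in> h_steps k l \<and> row_len k l i = u)"
proof (induction l)
  case (Cons x l)
  have ex_Suc_iff: "(\<exists>i. P i) \<longleftrightarrow> P 0 \<or> (\<exists>i. P (Suc i))" for P :: "nat \<Rightarrow> bool"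
    by (metis not0_implies_Suc)
  show ?case
    using Cons by (subst ex_Suc_iff) auto
qed simp

lemma card_h_steps:
  assumes "u \<noteq> 0"
  shows "card (h_steps k l \<inter> (H_cells k l u \<inter> V_cells k l v)) = step_count k l u v"
proof -
  let ?S = "{c \<in> h_steps k l. row_len k l (fst c) = u \<and> col_ht k l (snd c) = v}"
  have "h_steps k l \<inter> (H_cells k l u \<inter> V_cells k l v) = ?S"
    by (auto simp: H_cells_def V_cells_def h_steps_def)
  moreover have "inj_on snd ?S"
    by (auto simp: inj_on_def h_steps_def) (metis linorder_neqE_nat)+
  then have "card ?S = card (snd ` ?S)"
    by (rule card_image[symmetric])
  moreover have "snd ` ?S = {j. base_row_len k l j = u \<and> col_ht k l j = v}"
    unfolding base_row_len_eq_iff[OF assms] by force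
  ultimately show ?thesis
    by (simp only: step_count_def)
qed

definition irreducible_at :: "nat \<Rightarrow> nat list \<Rightarrow> nat \<Rightarrow> bool" where
  "irreducible_at k l u \<longleftrightarrow> step_count k l u (k - u) < u \<and> step_count k l u (k + 1 - u) < u"

lemma irreducible_k_shapes_iff:
  "l \<in> irreducible_k_shapes k \<longleftrightarrow> k_shape k l \<and> (\<forall>u\<in>{1..k}. irreducible_at k l u)"
proof -
  have "card (h_steps k l \<inter> (H_cells k l u \<inter> V_cells k l v)) \<le> u - 1 \<longleftrightarrow> step_count k l u v < u"
    if "u \<in> {1..k}" for u v
    using that card_h_steps[of u k l v] by auto
  then show ?thesis
    by (simp add: irreducible_k_shapes_def irreducible_at_def)
qed

section \<open>Removing the bottom row of a \<open>k\<close>-shape\<close>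

definition width :: "nat list \<Rightarrow> nat" where
  "width l = (case l of [] \<Rightarrow> 0 | x # _ \<Rightarrow> x)"

lemma width_Cons [simp]: "width (x # l) = x"
  by (simp add: width_def)

lemma is_partition_Cons_iff: "is_partition (x # l) \<longleftrightarrow> is_partition l \<and> 0 < x \<and> width l \<le> x"
  by (auto simp: is_partition_def width_def split: list.split)

lemma full_ht_pos_iff: "is_partition l \<Longrightarrow> 0 < full_ht l j \<longleftrightarrow> j < width l"
  by (induction l) (auto simp: is_partition_Cons_iff width_def)

lemma col_ht_eq_0: "is_partition l \<Longrightarrow> width l \<le> j \<Longrightarrow> col_ht k l j = 0"
  using full_ht_pos_iff[of l j] col_ht_le_full_ht[of k l j] by simp

lemma finite_columns_of_height:
  assumes "is_partition l" "0 < v"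
  shows "finite {j. P j \<and> col_ht k l j = v}"
proof (rule finite_subset)
  have "j < width l" if "col_ht k l j = v" for j
    using that assms col_ht_eq_0[of l j k] by (cases "width l \<le> j") auto
  then show "{j. P j \<and> col_ht k l j = v} \<subseteq> {..<width l}"
    by auto
qed simp

lemma k_shape_iff:
  "k_shape k l \<longleftrightarrow> is_partition l \<and> sorted_wrt (\<ge>) (row_seq k l) \<and> antimono (col_ht k l)"
proof -
  have "sorted_wrt (\<ge>) (col_seq k l) \<longleftrightarrow> antimono (col_ht k l)" if "is_partition l"
  proof -
    have "col_seq k l = map (col_ht k l) [0..<width l]"
      by (cases l) (simp_all add: col_seq_def width_def)
    then have "sorted_wrt (\<ge>) (col_seq k l) \<longleftrightarrow>
        (\<forall>i j. i < j \<longrightarrow> j < width l \<longrightarrow> col_ht k l j \<le> col_ht k l i)"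
      by (simp add: sorted_wrt_map sorted_wrt_iff_nth_less)
    also have "\<dots> \<longleftrightarrow> antimono (col_ht k l)"
      using col_ht_eq_0[OF that, of _ k] unfolding antimono_def
      by (metis le_zero_eq linorder_not_le nat_less_le)
    finally show ?thesis .
  qed
  then show ?thesis
    by (auto simp: k_shape_def)
qed

lemma k_shape_ConsD:
  assumes "k_shape k (x # l)"
  shows "k_shape k l"
proof -
  have antimono: "antimono (col_ht k (x # l))" and partition: "is_partition l"
    using assms by (simp_all add: k_shape_iff is_partition_Cons_iff)
  have "antimono (col_ht k l)"
  proof (rule antimonoI)
    fix i j :: nat
    assume "i \<le> j"
    show "col_ht k l j \<le> col_ht k l i"
    proof (cases "j < width l")
      case True
      then have "j < x"
        using assms by (simp add: k_shape_iff is_partition_Cons_iff)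
      with \<open>i \<le> j\<close> have "i \<in> bottom_row k x l \<Longrightarrow> j \<in> bottom_row k x l"
        using mem_bottom_row_iff[of _ k x l] by auto
      then show ?thesis
        using antimonoD[OF antimono \<open>i \<le> j\<close>] by (auto split: if_splits)
    qed (simp add: col_ht_eq_0[OF partition])
  qed
  then show ?thesis
    using assms by (simp add: k_shape_iff is_partition_Cons_iff)
qed

lemma k_shape_appendD: "k_shape k (ys @ l) \<Longrightarrow> k_shape k l"
  by (induction ys) (auto dest: k_shape_ConsD)

section \<open>Rows of a common length\<close>

text \<open>The entries \<open>d ! 1, d ! 2, \<dots>\<close> of the word \<open>d\<close> count the columns of full height
  \<open>length d - 1, length d - 2, \<dots>\<close>; all higher columns are finished, that is, cannot be met by the
  \<open>k\<close>-boundary of a row added below. The entry \<open>d ! 0\<close> is the number of columns that the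
  next row will create.\<close>

locale column_profile =
  fixes k :: nat and l d :: "nat list"
  assumes k_shape: "k_shape k l"
    and nonempty: "d \<noteq> []"
    and card_columns: "1 \<le> h \<Longrightarrow> h < length d \<Longrightarrow> card {j. full_ht l j = h} = d ! (length d - h)"
    and col_ht_active: "full_ht l j < length d \<Longrightarrow> col_ht k l j = full_ht l j"
    and col_ht_finished: "length d \<le> full_ht l j \<Longrightarrow> length d \<le> col_ht k l j"
begin

lemma partition: "is_partition l"
  and rows_sorted: "sorted_wrt (\<ge>) (row_seq k l)"
  and columns_antimono: "antimono (col_ht k l)"
  using k_shape by (simp_all add: k_shape_iff)

lemmas full_ht_pos = full_ht_pos_iff[OF partition]

lemma full_ht_eq_0: "full_ht l j = 0 \<longleftrightarrow> width l \<le> j"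
  using full_ht_pos[of j] by linarith

lemma finite_columns: "0 < h \<Longrightarrow> finite {j. full_ht l j = h}"
  by (rule finite_subset[of _ "{..<width l}"]) (auto simp flip: full_ht_pos)

end

definition add_row :: "nat \<Rightarrow> nat list \<Rightarrow> nat list" where
  "add_row a l = (width l + a) # l"

definition active_columns :: "nat list \<Rightarrow> nat list \<Rightarrow> nat set" where
  "active_columns d l = {j. j < width l + hd d \<and> full_ht l j < length d}"

text \<open>While rows of length \<open>u\<close> are added, columns are finished at height \<open>k + 1 - u\<close> first and at
  height \<open>k - u\<close> later.\<close>

locale row_phase = column_profile +
  fixes u :: nat
  assumes sum_list_eq: "sum_list d = u" and u_pos: "0 < u"
    and length_cases: "length d + u = k \<or> length d + u = k + 1"
    and row_seq_le: "r \<in> set (row_seq k l) \<Longrightarrow> r \<le> u"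
begin

lemma card_active_columns: "card (active_columns d l) = u"
proof -
  let ?H = "\<Union>h\<in>{1..<length d}. {j. full_ht l j = h}"
  have split: "active_columns d l = {width l..<width l + hd d} \<union> ?H"
    using nonempty full_ht_pos by (fastforce simp: active_columns_def Suc_le_eq not_less[symmetric])
  have disjoint: "{width l..<width l + hd d} \<inter> ?H = {}" and finite_H: "finite ?H"
    using full_ht_pos finite_columns by (fastforce simp: Suc_le_eq)+
  have "card ?H = (\<Sum>h\<in>{1..<length d}. d ! (length d - h))"
    using card_columns finite_columns by (subst card_UN_disjoint) (auto intro!: sum.cong)
  also have "\<dots> = (\<Sum>i\<in>{1..<length d}. d ! i)"
    by (rule sum.reindex_bij_witness[of _ "\<lambda>i. length d - i" "\<lambda>i. length d - i"]) auto
  finally have "card (active_columns d l) = hd d + (\<Sum>i\<in>{1..<length d}. d ! i)"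
    using disjoint finite_H by (simp add: split card_Un_disjoint)
  also have "\<dots> = (\<Sum>i\<in>{0..<length d}. d ! i)"
    using nonempty by (simp add: sum.atLeast_Suc_lessThan hd_conv_nth)
  finally show ?thesis
    by (simp add: sum_list_sum_nth[symmetric] sum_list_eq)
qed

lemma mem_active_columns_iff: "j \<in> active_columns d l \<longleftrightarrow> j < width l + hd d \<and> width l + hd d \<le> j + u"
proof -
  have "active_columns d l = {width l + hd d - card (active_columns d l)..<width l + hd d}"
    by (rule upward_closed_eq_interval)
      (auto simp: active_columns_def intro: le_less_trans[OF full_ht_antimono])
  then show ?thesis
    unfolding card_active_columns by auto
qed

lemma bottom_row_eq_active_columns: "bottom_row k (width l + hd d) l = active_columns d l"
proof (rule set_eqI)
  fix j
  show "j \<in> bottom_row k (width l + hd d) l \<longleftrightarrow> j \<in> active_columns d l"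
    using mem_active_columns_iff[of j] length_cases
    by (cases "full_ht l j < length d") (auto simp: bottom_row_def active_columns_def)
qed

lemma card_bottom_row_add_row: "card (bottom_row k (width l + hd d) l) = u"
  by (simp add: bottom_row_eq_active_columns card_active_columns)

lemma row_seq_add_row: "row_seq k (add_row (hd d) l) = u # row_seq k l"
  by (simp add: add_row_def card_bottom_row_add_row)

lemma full_ht_add_row:
  "full_ht (add_row (hd d) l) j = (if j < width l + hd d then 1 else 0) + full_ht l j"
  by (simp add: add_row_def)

lemma col_ht_add_row:
  "col_ht k (add_row (hd d) l) j = (if j \<in> active_columns d l then 1 else 0) + col_ht k l j"
  by (simp add: add_row_def bottom_row_eq_active_columns)

lemma base_row_len_add_row:
  "base_row_len k (add_row (hd d) l) j = (if j \<in> active_columns d l then u else base_row_len k l j)"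
  by (simp add: add_row_def bottom_row_eq_active_columns card_active_columns)

lemma length_le_full_ht_iff: "length d \<le> full_ht l j \<longleftrightarrow> j + u < width l + hd d"
  using mem_active_columns_iff[of j] full_ht_pos[of j] nonempty
  by (cases "j < width l + hd d") (auto simp: active_columns_def)

lemma u_le_width: "u \<le> width l + hd d"
  using card_bottom_row_le[of k "width l + hd d" l] by (simp add: card_bottom_row_add_row)

lemma card_columns_add_row:
  assumes "1 \<le> h" "h \<le> length d"
  shows "card {j. j < width l + hd d \<and> full_ht l j + 1 = h} = rotate1 d ! (length d - h)"
proof (cases "h = 1")
  case True
  then have "{j. j < width l + hd d \<and> full_ht l j + 1 = h} = {width l..<width l + hd d}"
    by (auto simp: full_ht_eq_0)
  then show ?thesis
    using True nonempty by (simp add: nth_rotate1 hd_conv_nth)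
next
  case False
  then have "{j. j < width l + hd d \<and> full_ht l j + 1 = h} = {j. full_ht l j = h - 1}"
  proof (intro Collect_cong)
    fix j
    show "j < width l + hd d \<and> full_ht l j + 1 = h \<longleftrightarrow> full_ht l j = h - 1"
      using assms False full_ht_eq_0[of j] by auto
  qed
  then show ?thesis
    using assms False card_columns[of "h - 1"] by (simp add: nth_rotate1 Suc_diff_le)
qed

lemma antimono_col_ht_add_row: "antimono (col_ht k (add_row (hd d) l))"
proof (rule antimonoI)
  fix i j :: nat
  assume "i \<le> j"
  then have heights_le: "full_ht l j \<le> full_ht l i" "col_ht k l j \<le> col_ht k l i"
    by (simp_all add: full_ht_antimono antimonoD[OF columns_antimono])
  show "col_ht k (add_row (hd d) l) j \<le> col_ht k (add_row (hd d) l) i"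
  proof (cases "full_ht l i < length d")
    case True
    then show ?thesis
      using heights_le col_ht_active[of i] col_ht_active[of j] \<open>i \<le> j\<close>
      by (simp add: col_ht_add_row active_columns_def)
  next
    case False
    then show ?thesis
      using heights_le col_ht_finished[of i] col_ht_active[of j] \<open>i \<le> j\<close>
      by (auto simp: col_ht_add_row active_columns_def)
  qed
qed

lemma k_shape_add_row: "k_shape k (add_row (hd d) l)"
proof -
  have "0 < width l + hd d"
    using u_pos u_le_width by linarith
  then have "is_partition (add_row (hd d) l)"
    using partition by (simp add: add_row_def is_partition_Cons_iff)
  then show ?thesis
    using rows_sorted row_seq_le antimono_col_ht_add_row by (simp add: k_shape_iff row_seq_add_row)
qed

lemma column_profile_add_row: "column_profile k (add_row (hd d) l) (rotate1 d)"
proof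
  show "card {j. full_ht (add_row (hd d) l) j = h} = rotate1 d ! (length (rotate1 d) - h)"
    if "1 \<le> h" "h < length (rotate1 d)" for h
  proof -
    have "{j. full_ht (add_row (hd d) l) j = h} = {j. j < width l + hd d \<and> full_ht l j + 1 = h}"
    proof (rule Collect_cong)
      fix j
      show "full_ht (add_row (hd d) l) j = h \<longleftrightarrow> j < width l + hd d \<and> full_ht l j + 1 = h"
        using that full_ht_eq_0[of j] by (auto simp: full_ht_add_row)
    qed
    then show ?thesis
      using card_columns_add_row that by simp
  qed
  show "col_ht k (add_row (hd d) l) j = full_ht (add_row (hd d) l) j"
    if "full_ht (add_row (hd d) l) j < length (rotate1 d)" for j
    using that col_ht_active[of j]
    by (auto simp: full_ht_add_row col_ht_add_row active_columns_def split: if_splits)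
  show "length (rotate1 d) \<le> col_ht k (add_row (hd d) l) j"
    if "length (rotate1 d) \<le> full_ht (add_row (hd d) l) j" for j
    using that col_ht_active[of j] col_ht_finished[of j] full_ht_pos[of j]
    by (auto simp: full_ht_add_row col_ht_add_row active_columns_def split: if_splits)
qed (simp_all add: k_shape_add_row nonempty)

lemma row_phase_add_row: "row_phase k (add_row (hd d) l) (rotate1 d) u"
proof -
  interpret column_profile k "add_row (hd d) l" "rotate1 d"
    by (rule column_profile_add_row)
  have "sum_list (rotate1 d) = u"
    using sum_list_eq by (cases d) auto
  then show ?thesis
    using u_pos length_cases row_seq_le by unfold_locales (auto simp: row_seq_add_row)
qed

lemma card_columns_raised:
  assumes "1 \<le> v"
  shows "card {j \<in> active_columns d l. full_ht l j + 1 = v} =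
    (if v \<le> length d then rotate1 d ! (length d - v) else 0)"
proof (cases "v \<le> length d")
  case True
  then have "{j \<in> active_columns d l. full_ht l j + 1 = v} =
      {j. j < width l + hd d \<and> full_ht l j + 1 = v}"
    by (auto simp: active_columns_def)
  then show ?thesis
    using True assms card_columns_add_row by simp
next
  case False
  then have "{j \<in> active_columns d l. full_ht l j + 1 = v} = {}"
    by (auto simp: active_columns_def)
  then show ?thesis
    using False by (simp only: card.empty) simp
qed

lemma card_columns_kept:
  assumes "1 \<le> v"
  shows "card {j. j \<notin> active_columns d l \<and> base_row_len k l j = u \<and> col_ht k l j = v} =
    (if length d \<le> v then step_count k l u v else 0)"
proof (cases "length d \<le> v")
  case True
  then have "{j. j \<notin> active_columns d l \<and> base_row_len k l j = u \<and> col_ht k l j = v} =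
      {j. base_row_len k l j = u \<and> col_ht k l j = v}"
    using col_ht_active by (auto simp: active_columns_def)
  then show ?thesis
    using True by (simp add: step_count_def)
next
  case False
  have "col_ht k l j \<noteq> v" if "j \<notin> active_columns d l" for j
    using that False assms col_ht_finished[of j] col_ht_eq_0[OF partition, of j k]
    by (force simp: active_columns_def)
  then have "{j. j \<notin> active_columns d l \<and> base_row_len k l j = u \<and> col_ht k l j = v} = {}"
    by auto
  then show ?thesis
    using False by (simp only: card.empty) simp
qed

lemma step_count_add_row:
  assumes "1 \<le> v"
  shows "step_count k (add_row (hd d) l) u v =
    (if v \<le> length d then rotate1 d ! (length d - v) else 0) +
    (if length d \<le> v then step_count k l u v else 0)"
proof -
  let ?raised = "{j \<in> active_columns d l. full_ht l j + 1 = v}"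
  let ?kept = "{j. j \<notin> active_columns d l \<and> base_row_len k l j = u \<and> col_ht k l j = v}"
  have "{j. base_row_len k (add_row (hd d) l) j = u \<and> col_ht k (add_row (hd d) l) j = v} =
      ?raised \<union> ?kept"
    using col_ht_active by (auto simp: base_row_len_add_row col_ht_add_row active_columns_def)
  moreover have "finite ?raised" "finite ?kept"
    using assms finite_columns_of_height[OF partition]
    by (auto simp: active_columns_def conj_assoc)
  moreover have "?raised \<inter> ?kept = {}"
    by auto
  ultimately have "step_count k (add_row (hd d) l) u v = card ?raised + card ?kept"
    by (simp add: step_count_def card_Un_disjoint)
  then show ?thesis
    by (simp only: card_columns_raised[OF assms] card_columns_kept[OF assms])
qed

lemma step_count_add_row_shorter:
  "u' < u \<Longrightarrow> k \<le> u' + v \<Longrightarrow> step_count k (add_row (hd d) l) u' v = step_count k l u' v"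
  by (simp add: add_row_def step_count_Cons_shorter card_bottom_row_add_row)

end

primrec add_rows :: "nat \<Rightarrow> nat list \<Rightarrow> nat list \<Rightarrow> nat list" where
  "add_rows 0 d l = l"
| "add_rows (Suc n) d l = add_row (hd (rotate n d)) (add_rows n d l)"

lemma drop_add_rows: "drop n (add_rows n d l) = l"
  by (induction n) (simp_all add: add_row_def)

context row_phase
begin

lemma row_phase_add_rows: "row_phase k (add_rows n d l) (rotate n d) u"
  by (induction n) (auto intro: row_phase_axioms row_phase.row_phase_add_row)

lemma row_seq_add_rows: "row_seq k (add_rows n d l) = replicate n u @ row_seq k l"
  by (induction n) (auto simp: row_phase.row_seq_add_row[OF row_phase_add_rows])

lemma step_count_add_rows_eq:
  "step_count k (add_rows n d l) u (length d) = step_count k l u (length d) + rotation_sum n d"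
proof (induction n)
  case (Suc n)
  have "1 \<le> length d"
    using nonempty by (simp add: Suc_le_eq)
  then show ?case
    using row_phase.step_count_add_row[OF row_phase_add_rows[of n], of "length d"] Suc nonempty
    by (simp add: rotation_sum_Suc hd_conv_nth)
qed simp

lemma step_count_add_rows_less:
  "1 \<le> v \<Longrightarrow> v < length d \<Longrightarrow>
     step_count k (add_rows (Suc n) d l) u v = rotate (Suc n) d ! (length d - v)"
  using row_phase.step_count_add_row[OF row_phase_add_rows[of n], of v] by simp

lemma step_count_add_rows_greater:
  "length d < v \<Longrightarrow> step_count k (add_rows n d l) u v = step_count k l u v"
  by (induction n) (simp_all add: row_phase.step_count_add_row[OF row_phase_add_rows])

lemma step_count_add_rows_shorter:
  "u' < u \<Longrightarrow> k \<le> u' + v \<Longrightarrow> step_count k (add_rows n d l) u' v = step_count k l u' v"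
  by (induction n) (simp_all add: row_phase.step_count_add_row_shorter[OF row_phase_add_rows])

end

section \<open>Phases, interrupted by a merge\<close>

fun merge_hd :: "nat list \<Rightarrow> nat list" where
  "merge_hd (a # b # d) = (a + b) # d"
| "merge_hd d = d"

fun incr_hd :: "nat list \<Rightarrow> nat list" where
  "incr_hd (a # d) = Suc a # d"
| "incr_hd [] = []"

lemma length_incr_hd [simp]: "length (incr_hd d) = length d"
  by (cases d) auto

lemma sum_list_incr_hd: "d \<noteq> [] \<Longrightarrow> sum_list (incr_hd d) = Suc (sum_list d)"
  by (cases d) auto

lemma hd_incr_hd: "d \<noteq> [] \<Longrightarrow> hd (incr_hd d) = Suc (hd d)"
  by (cases d) auto

lemma length_merge_hd: "2 \<le> length d \<Longrightarrow> length (merge_hd d) = length d - 1"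
  by (cases d rule: merge_hd.cases) auto

lemma sum_list_merge_hd [simp]: "sum_list (merge_hd d) = sum_list d"
  by (cases d rule: merge_hd.cases) auto

context column_profile
begin

lemma column_profile_incr_hd: "column_profile k l (incr_hd d)"
  by (cases d) (use column_profile_axioms in \<open>auto simp: column_profile_def nth_Cons'\<close>)

text \<open>The merge finishes the \<open>d ! 1\<close> columns of full height \<open>length d - 1\<close>, and the next row
  replaces them by as many new columns.\<close>

lemma column_profile_merge_hd:
  assumes "2 \<le> length d"
  shows "column_profile k l (merge_hd d)"
proof -
  obtain a b r where d_eq: "d = a # b # r"
    using assms by (cases d rule: merge_hd.cases) auto
  show ?thesis
  proof
    show "card {j. full_ht l j = h} = merge_hd d ! (length (merge_hd d) - h)"
      if "1 \<le> h" "h < length (merge_hd d)" for h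
      using that card_columns[of h] by (auto simp: d_eq nth_Cons' Suc_diff_le)
    show "col_ht k l j = full_ht l j" if "full_ht l j < length (merge_hd d)" for j
      using that col_ht_active[of j] by (simp add: d_eq)
    show "length (merge_hd d) \<le> col_ht k l j" if "length (merge_hd d) \<le> full_ht l j" for j
      using that col_ht_active[of j] col_ht_finished[of j]
      by (cases "full_ht l j < length d") (auto simp: d_eq)
  qed (simp_all add: k_shape d_eq)
qed

end

definition phase_word :: "nat \<Rightarrow> nat \<Rightarrow> nat list \<Rightarrow> nat list" where
  "phase_word x y d = rotate y (merge_hd (rotate x d))"

definition add_phase :: "nat \<Rightarrow> nat \<Rightarrow> nat list \<Rightarrow> nat list \<Rightarrow> nat list" where
  "add_phase x y d l = add_rows y (merge_hd (rotate x d)) (add_rows x d l)"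

lemma drop_add_phase: "drop (x + y) (add_phase x y d l) = l"
  by (simp add: add_phase_def drop_add_rows flip: drop_drop)

locale full_phase = row_phase +
  assumes length_eq: "length d + u = k + 1" and two_le_length: "2 \<le> length d"
    and new_length: "u \<notin> set (row_seq k l)" and hd_pos: "0 < hd d"
begin

lemma row_phase_merge_hd: "row_phase k (add_rows x d l) (merge_hd (rotate x d)) u"
proof -
  interpret rows: row_phase k "add_rows x d l" "rotate x d" u
    by (rule row_phase_add_rows)
  interpret column_profile k "add_rows x d l" "merge_hd (rotate x d)"
    using two_le_length by (intro rows.column_profile_merge_hd) simp
  show ?thesis
    using rows.sum_list_eq u_pos length_eq two_le_length rows.row_seq_le
    by unfold_locales (simp_all add: length_merge_hd)
qed

lemma row_phase_add_phase: "row_phase k (add_phase x y d l) (phase_word x y d) u"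
  unfolding add_phase_def phase_word_def
  by (rule row_phase.row_phase_add_rows[OF row_phase_merge_hd])

lemma row_seq_add_phase: "row_seq k (add_phase x y d l) = replicate (y + x) u @ row_seq k l"
  by (simp add: add_phase_def row_phase.row_seq_add_rows[OF row_phase_merge_hd] row_seq_add_rows
      replicate_add)

lemma step_count_add_phase_lax: "step_count k (add_phase x y d l) u (k + 1 - u) = rotation_sum x d"
proof -
  have "length (merge_hd (rotate x d)) < k + 1 - u" "k + 1 - u = length d"
    using length_eq two_le_length by (simp_all add: length_merge_hd)
  then show ?thesis
    using row_phase.step_count_add_rows_greater[OF row_phase_merge_hd] step_count_add_rows_eq
      step_count_eq_0[of u k l] u_pos new_length by (simp add: add_phase_def)
qed

lemma step_count_add_phase_strict:
  "step_count k (add_phase x y d l) u (k - u) =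
     (if x = 0 then 0 else rotate x d ! 1) + rotation_sum y (merge_hd (rotate x d))"
proof -
  have lengths: "k - u = length d - 1" "length (merge_hd (rotate x d)) = length d - 1"
    using length_eq two_le_length by (simp_all add: length_merge_hd)
  have "step_count k (add_rows x d l) u (length d - 1) = (if x = 0 then 0 else rotate x d ! 1)"
  proof (cases x)
    case 0
    then show ?thesis
      using step_count_eq_0[of u k l] u_pos new_length by simp
  next
    case (Suc n)
    then show ?thesis
      using step_count_add_rows_less[of "length d - 1" n] two_le_length by simp
  qed
  then show ?thesis
    using row_phase.step_count_add_rows_eq[OF row_phase_merge_hd, of y x] lengths
    by (simp add: add_phase_def)
qed

lemma step_count_add_phase_shorter:
  "u' < u \<Longrightarrow> k \<le> u' + v \<Longrightarrow> step_count k (add_phase x y d l) u' v = step_count k l u' v"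
  by (simp add: add_phase_def row_phase.step_count_add_rows_shorter[OF row_phase_merge_hd]
      step_count_add_rows_shorter)

lemma irreducible_at_add_phase_shorter:
  "0 < u' \<Longrightarrow> u' < u \<Longrightarrow> irreducible_at k (add_phase x y d l) u' \<longleftrightarrow> irreducible_at k l u'"
  using step_count_add_phase_shorter[of u' "k - u'"]
    step_count_add_phase_shorter[of u' "k + 1 - u'"]
  by (simp add: irreducible_at_def)

lemma irreducible_at_add_phase:
  assumes "x < length d" "0 < d ! x" "Suc y < length d"
  shows "irreducible_at k (add_phase x y d l) u"
proof -
  have "step_count k (add_phase x y d l) u (k + 1 - u) < u"
    using rotation_sum_plus_hd_le[OF assms(1)] hd_pos step_count_add_phase_lax[of x y]
    by (simp add: sum_list_eq)
  moreover have "step_count k (add_phase x y d l) u (k - u) < u"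
  proof -
    let ?e = "merge_hd (rotate x d)"
    have "2 \<le> length (rotate x d)"
      using two_le_length by simp
    then obtain a b r where rotate_eq: "rotate x d = a # b # r"
      by (cases "rotate x d" rule: merge_hd.cases) auto
    have "hd ?e = d ! x + b" "rotate x d ! 1 = b"
      using hd_rotate[OF assms(1)] by (simp_all add: rotate_eq)
    moreover have "y < length ?e"
      using assms(3) by (simp add: length_merge_hd)
    then have "rotation_sum y ?e + hd ?e \<le> u"
      using rotation_sum_plus_hd_le[of y ?e] by (simp add: sum_list_rotate sum_list_eq)
    ultimately show ?thesis
      using assms(2) step_count_add_phase_strict[of x y] by (cases "x = 0") simp_all
  qed
  ultimately show ?thesis
    by (simp add: irreducible_at_def)
qed

end

lemma (in column_profile) full_phase_incr_hd:
  assumes "length d + sum_list d = k" "2 \<le> length d" "\<And>r. r \<in> set (row_seq k l) \<Longrightarrow> r \<le> sum_list d"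
  shows "full_phase k l (incr_hd d) (Suc (sum_list d))"
proof -
  interpret incr: column_profile k l "incr_hd d"
    by (rule column_profile_incr_hd)
  show ?thesis
    using assms nonempty by unfold_locales (force simp: sum_list_incr_hd hd_incr_hd)+
qed

section \<open>Codes of irreducible shapes\<close>

text \<open>A code lists, from the longest rows to the shortest, one pair \<open>(x, y)\<close> for each row length
  \<open>u\<close>: first come \<open>x\<close> rows during which a column may reach height \<open>k + 1 - u\<close>, then \<open>y\<close> rows
  during which columns are finished at height \<open>k - u\<close>. The bounds in \<open>valid_code\<close> express
  irreducibility, and \<open>0 < incr_hd (code_word k cs) ! x\<close> makes \<open>x\<close> unique: the last of the \<open>x\<close> rows
  meets a column of height \<open>k + 1 - u\<close>.\<close>

fun code_word :: "nat \<Rightarrow> (nat \<times> nat) list \<Rightarrow> nat list" where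
  "code_word k [] = replicate k 0"
| "code_word k ((x, y) # cs) = phase_word x y (incr_hd (code_word k cs))"

fun code_shape :: "nat \<Rightarrow> (nat \<times> nat) list \<Rightarrow> nat list" where
  "code_shape k [] = []"
| "code_shape k ((x, y) # cs) = add_phase x y (incr_hd (code_word k cs)) (code_shape k cs)"

fun valid_code :: "nat \<Rightarrow> (nat \<times> nat) list \<Rightarrow> bool" where
  "valid_code k [] \<longleftrightarrow> True"
| "valid_code k ((x, y) # cs) \<longleftrightarrow> valid_code k cs \<and>
     x < length (code_word k cs) \<and> 0 < incr_hd (code_word k cs) ! x \<and>
     Suc y < length (code_word k cs)"

definition codes :: "nat \<Rightarrow> nat \<Rightarrow> (nat \<times> nat) list set" where
  "codes k n = {cs. valid_code k cs \<and> length cs = n}"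

lemma valid_code_induct [consumes 1, case_names Nil Cons]:
  assumes "valid_code k cs" "P []"
    and "\<And>x y cs. valid_code k ((x, y) # cs) \<Longrightarrow> valid_code k cs \<Longrightarrow> P cs \<Longrightarrow> P ((x, y) # cs)"
  shows "P cs"
  using assms(1)
proof (induction cs)
  case (Cons c cs)
  then show ?case
    using assms(3) by (cases c) simp
qed (rule assms(2))

lemma length_code_word: "valid_code k cs \<Longrightarrow> length (code_word k cs) = k - length cs"
  by (induction rule: valid_code_induct) (auto simp: phase_word_def length_merge_hd)

lemma sum_list_code_word: "valid_code k cs \<Longrightarrow> sum_list (code_word k cs) = length cs"
proof (induction rule: valid_code_induct)
  case (Cons x y cs)
  then have "code_word k cs \<noteq> []"
    by auto
  with Cons show ?case
    by (simp add: phase_word_def sum_list_rotate sum_list_incr_hd)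
qed simp

lemma column_profile_Nil: "0 < k \<Longrightarrow> column_profile k [] (replicate k 0)"
  by (auto simp: column_profile_def k_shape_iff is_partition_def antimono_def)

lemma column_profile_code:
  "valid_code k cs \<Longrightarrow> 0 < k \<Longrightarrow> column_profile k (code_shape k cs) (code_word k cs) \<and>
     (\<forall>r\<in>set (row_seq k (code_shape k cs)). r \<le> length cs)"
proof (induction rule: valid_code_induct)
  case (Cons x y cs)
  then interpret column_profile k "code_shape k cs" "code_word k cs"
    by simp
  have "full_phase k (code_shape k cs) (incr_hd (code_word k cs)) (Suc (sum_list (code_word k cs)))"
    using Cons by (intro full_phase_incr_hd) (auto simp: sum_list_code_word length_code_word)
  then interpret full_phase k "code_shape k cs" "incr_hd (code_word k cs)" "Suc (length cs)"
    using Cons by (simp add: sum_list_code_word)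
  interpret rows: row_phase k "code_shape k ((x, y) # cs)" "code_word k ((x, y) # cs)"
      "Suc (length cs)"
    using row_phase_add_phase by simp
  show ?case
    using rows.column_profile_axioms rows.row_seq_le by simp
qed (simp add: column_profile_Nil)

lemma full_phase_code:
  assumes "valid_code k ((x, y) # cs)"
  shows "full_phase k (code_shape k cs) (incr_hd (code_word k cs)) (Suc (length cs))"
proof -
  have valid: "valid_code k cs" "0 < k"
    using assms by (auto simp: length_code_word)
  interpret column_profile k "code_shape k cs" "code_word k cs"
    using column_profile_code[OF valid] by blast
  show ?thesis
    using full_phase_incr_hd column_profile_code[OF valid] assms
    by (auto simp: sum_list_code_word length_code_word)
qed

lemma irreducible_at_code_shape:
  "valid_code k cs \<Longrightarrow> u \<in> {1..length cs} \<Longrightarrow> irreducible_at k (code_shape k cs) u"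
proof (induction rule: valid_code_induct)
  case (Cons x y cs)
  interpret full_phase k "code_shape k cs" "incr_hd (code_word k cs)" "Suc (length cs)"
    by (rule full_phase_code[OF Cons.hyps(1)])
  show ?case
  proof (cases "u = Suc (length cs)")
    case True
    then show ?thesis
      using irreducible_at_add_phase[of x y] Cons.hyps(1) by simp
  next
    case False
    then show ?thesis
      using Cons irreducible_at_add_phase_shorter[of u] by simp
  qed
qed simp

lemma code_shape_irreducible:
  assumes "cs \<in> codes k (k - 1)" "0 < k"
  shows "code_shape k cs \<in> irreducible_k_shapes k"
proof -
  have valid: "valid_code k cs" "length cs = k - 1"
    using assms(1) by (simp_all add: codes_def)
  interpret column_profile k "code_shape k cs" "code_word k cs"
    using column_profile_code valid(1) assms(2) by blast
  have "irreducible_at k (code_shape k cs) u" if "u \<in> {1..k}" for u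
  proof (cases "u = k")
    case True
    then have "u \<notin> set (row_seq k (code_shape k cs))"
      using column_profile_code[OF valid(1) assms(2)] valid(2) assms(2) by force
    then show ?thesis
      using step_count_eq_0[of u k "code_shape k cs"] that by (simp add: irreducible_at_def)
  next
    case False
    then show ?thesis
      using that valid by (intro irreducible_at_code_shape) auto
  qed
  then show ?thesis
    using k_shape by (simp add: irreducible_k_shapes_iff)
qed

lemma code_shape_inject:
  assumes "valid_code k cs" "valid_code k cs'" "length cs = length cs'"
    and "code_shape k cs = code_shape k cs'"
  shows "cs = cs'"
  using assms(3,1,2,4)
proof (induction cs cs' rule: list_induct2)
  case (Cons c cs c' cs')
  obtain x y x' y' where pairs: "c = (x, y)" "c' = (x', y')"
    by (cases c, cases c')
  note valid = Cons.prems(1)[unfolded pairs] and valid' = Cons.prems(2)[unfolded pairs]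
  let ?d = "incr_hd (code_word k cs)"
  interpret full_phase k "code_shape k cs" ?d "Suc (length cs)"
    by (rule full_phase_code[OF valid])
  interpret other: full_phase k "code_shape k cs'" "incr_hd (code_word k cs')" "Suc (length cs')"
    by (rule full_phase_code[OF valid'])
  have shapes_eq: "add_phase x y ?d (code_shape k cs) =
      add_phase x' y' (incr_hd (code_word k cs')) (code_shape k cs')"
    using Cons.prems(3) by (simp add: pairs)
  have "y + x = y' + x'"
    using arg_cong[OF shapes_eq, of "\<lambda>l. count_list (row_seq k l) (Suc (length cs))"] new_length
      other.new_length Cons.hyps
    by (simp add: row_seq_add_phase other.row_seq_add_phase count_list_replicate)
  then have "code_shape k cs = code_shape k cs'"
    using shapes_eq by (metis add.commute drop_add_phase)
  then have "cs = cs'"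
    using Cons.IH valid valid' by simp
  have "rotation_sum x ?d = rotation_sum x' ?d"
    using shapes_eq step_count_add_phase_lax unfolding \<open>cs = cs'\<close> by metis
  then have "x = x'"
    using rotation_sum_inject[of x ?d x'] valid valid' \<open>cs = cs'\<close> by simp
  then show ?case
    using \<open>cs = cs'\<close> \<open>y + x = y' + x'\<close> by (simp add: pairs)
qed simp

lemma inj_on_code_shape: "inj_on (code_shape k) (codes k n)"
  by (rule inj_onI) (auto simp: codes_def intro: code_shape_inject)

lemma step_count_code_eq_0_iff:
  "valid_code k cs \<Longrightarrow> n < length cs \<Longrightarrow>
     step_count k (code_shape k cs) (length cs - n) (k + 1 - (length cs - n)) = 0 \<longleftrightarrow>
     fst (cs ! n) = 0"
proof (induction arbitrary: n rule: valid_code_induct)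
  case (Cons x y cs)
  interpret full_phase k "code_shape k cs" "incr_hd (code_word k cs)" "Suc (length cs)"
    by (rule full_phase_code[OF Cons.hyps(1)])
  show ?case
  proof (cases n)
    case 0
    have "rotation_sum x (incr_hd (code_word k cs)) = 0 \<longleftrightarrow> x = 0"
      using rotation_sum_strict_mono[of 0 x "incr_hd (code_word k cs)"] Cons.hyps(1)
      by (cases "x = 0") auto
    then show ?thesis
      using step_count_add_phase_lax[of x y] by (simp add: 0)
  next
    case (Suc n')
    then show ?thesis
      using Cons step_count_add_phase_shorter[of "length cs - n'" "k + 1 - (length cs - n')"]
      by simp
  qed
qed simp

section \<open>Every irreducible shape has a code\<close>

definition meets_height :: "nat \<Rightarrow> nat list \<Rightarrow> nat \<Rightarrow> bool" where
  "meets_height k l v \<longleftrightarrow> (\<exists>j. (0, j) \<in> k_boundary k l \<and> col_ht k l j = v)"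

text \<open>When the bottom row of the \<open>k\<close>-boundary has length \<open>u\<close>, the columns \<open>j\<close> with
  \<open>j + u < width l\<close> are those to its left.\<close>

definition left_height :: "nat \<Rightarrow> nat \<Rightarrow> nat list \<Rightarrow> nat \<Rightarrow> bool" where
  "left_height k u l v \<longleftrightarrow> (\<exists>j. j + u < width l \<and> col_ht k l j = v)"

lemma not_left_height_if_meets_height:
  assumes "k_shape k (x # l)" "meets_height k (x # l) v" "v' < v"
  shows "\<not> left_height k (card (bottom_row k x l)) (x # l) v'"
proof
  assume "left_height k (card (bottom_row k x l)) (x # l) v'"
  then obtain j where left: "j + card (bottom_row k x l) < x" "col_ht k (x # l) j = v'"
    by (auto simp: left_height_def)
  obtain j' where met: "j' \<in> bottom_row k x l" "col_ht k (x # l) j' = v"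
    using assms(2) by (auto simp: meets_height_def)
  have "j \<le> j'"
    using left(1) met(1) mem_bottom_row_iff[of j' k x l] by simp
  then have "col_ht k (x # l) j' \<le> col_ht k (x # l) j"
    using assms(1) by (auto simp: k_shape_iff dest: antimonoD)
  with left(2) met(2) assms(3) show False
    by simp
qed

lemma left_height_Cons:
  assumes "is_partition (x # l)" "card (bottom_row k x l) = u" "left_height k u l v"
  shows "left_height k u (x # l) v"
proof -
  obtain j where left: "j + u < width l" "col_ht k l j = v"
    using assms(3) by (auto simp: left_height_def)
  then have "j + u < x" "j \<notin> bottom_row k x l"
    using assms(1,2) mem_bottom_row_iff[of j k x l] by (auto simp: is_partition_Cons_iff)
  then show ?thesis
    using left by (auto simp: left_height_def)
qed

context row_phase
begin

lemma Cons_eq_add_rowI: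
  assumes "u \<le> x" "full_ht l (x - u) < length d" "u < x \<Longrightarrow> length d \<le> full_ht l (x - Suc u)"
  shows "x # l = add_row (hd d) l"
proof -
  have "width l + hd d \<le> x"
    using assms(1,2) length_le_full_ht_iff[of "x - u"] by simp
  moreover have "x \<le> width l + hd d"
    using assms(1,3) length_le_full_ht_iff[of "x - Suc u"] u_le_width by (cases "u < x") auto
  ultimately show ?thesis
    by (simp add: add_row_def)
qed

lemma Cons_eq_add_row_strict:
  assumes "length d + u = k" "card (bottom_row k x l) = u" "\<not> meets_height k (x # l) (k + 1 - u)"
  shows "x # l = add_row (hd d) l"
proof (rule Cons_eq_add_rowI)
  show "u \<le> x"
    using card_bottom_row_le[of k x l] by (simp add: assms(2))
  show "full_ht l (x - u) < length d"
  proof (rule ccontr)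
    assume "\<not> full_ht l (x - u) < length d"
    then have "col_ht k l (x - u) = length d"
      using card_bottom_row_plus_full_ht_le[of k x l] col_ht_finished[of "x - u"]
        col_ht_le_full_ht[of k l "x - u"] assms(1,2) u_pos by simp
    moreover have "x - u \<in> bottom_row k x l"
      using \<open>u \<le> x\<close> u_pos assms(2) by (subst mem_bottom_row_iff) simp
    ultimately have "col_ht k (x # l) (x - u) = k + 1 - u"
      using assms(1) by simp
    with \<open>x - u \<in> bottom_row k x l\<close> assms(3) show False
      by (auto simp: meets_height_def)
  qed
  show "length d \<le> full_ht l (x - Suc u)" if "u < x"
    using less_Suc_card_bottom_row_plus_full_ht[of k x l] that assms(1,2) by simp
qed

lemma Cons_eq_add_row_lax:
  assumes "length d + u = k + 1" "card (bottom_row k x l) = u" "\<not> left_height k u (x # l) (k - u)"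
  shows "x # l = add_row (hd d) l"
proof (rule Cons_eq_add_rowI)
  show "u \<le> x"
    using card_bottom_row_le[of k x l] by (simp add: assms(2))
  show "full_ht l (x - u) < length d"
    using card_bottom_row_plus_full_ht_le[of k x l] assms(1,2) u_pos by simp
  show "length d \<le> full_ht l (x - Suc u)" if "u < x"
  proof (rule ccontr)
    assume "\<not> length d \<le> full_ht l (x - Suc u)"
    then have "col_ht k l (x - Suc u) = k - u"
      using less_Suc_card_bottom_row_plus_full_ht[of k x l] col_ht_active[of "x - Suc u"] that
        assms(1,2) by simp
    moreover have "x - Suc u \<notin> bottom_row k x l"
      using that assms(2) by (subst mem_bottom_row_iff) simp
    ultimately have "col_ht k (x # l) (x - Suc u) = k - u"
      by simp
    moreover have "x - Suc u + u < width (x # l)"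
      using that by simp
    ultimately show False
      using assms(3) unfolding left_height_def by blast
  qed
qed

lemma append_eq_add_rows_lax:
  assumes "length d + u = k + 1"
  shows "k_shape k (ys @ l) \<Longrightarrow> row_seq k (ys @ l) = replicate (length ys) u @ row_seq k l \<Longrightarrow>
    \<not> left_height k u (ys @ l) (k - u) \<Longrightarrow> ys @ l = add_rows (length ys) d l"
proof (induction ys)
  case (Cons y ys)
  have card: "card (bottom_row k y (ys @ l)) = u"
    using Cons.prems(2) by simp
  have "\<not> left_height k u (ys @ l) (k - u)"
    using left_height_Cons[OF _ card] Cons.prems by (auto simp: k_shape_iff)
  then have IH: "ys @ l = add_rows (length ys) d l"
    using Cons by (auto dest: k_shape_ConsD)
  interpret rows: row_phase k "ys @ l" "rotate (length ys) d" u
    unfolding IH by (rule row_phase_add_rows)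
  show ?case
    using rows.Cons_eq_add_row_lax[OF _ card] assms Cons.prems(3) IH by simp
qed simp

lemma hd_rotate_pos_if_meets_height:
  assumes "length d + u = k + 1" "0 < n" "meets_height k (add_rows n d l) (k + 1 - u)"
  shows "0 < hd (rotate n d)"
proof -
  obtain n' where n_eq: "n = Suc n'"
    using assms(2) by (cases n) auto
  interpret rows: row_phase k "add_rows n' d l" "rotate n' d" u
    by (rule row_phase_add_rows)
  let ?A = "{j. j < width (add_rows n' d l) + hd (rotate n' d) \<and>
    full_ht (add_rows n' d l) j + 1 = length d}"
  have "k + 1 - u = length d"
    using assms(1) by simp
  then obtain j where "j \<in> ?A"
    using assms(3) rows.bottom_row_eq_active_columns rows.col_ht_active
    by (auto simp: n_eq meets_height_def add_row_def active_columns_def)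
  moreover have "finite ?A"
    by simp
  ultimately have "0 < card ?A"
    by (auto simp: card_gt_0_iff)
  then show ?thesis
    using rows.card_columns_add_row[of "length d"] nonempty
    by (simp add: n_eq hd_conv_nth Suc_le_eq)
qed

end

context full_phase
begin

lemma append_eq_add_phase:
  assumes "k_shape k (ys @ l)" "row_seq k (ys @ l) = replicate (length ys) u @ row_seq k l"
  shows "\<exists>x y. ys @ l = add_phase x y d l \<and> (0 < x \<longrightarrow> meets_height k (add_rows x d l) (k + 1 - u))"
  using assms
proof (induction ys)
  case Nil
  then show ?case
    by (intro exI[of _ 0]) (simp add: add_phase_def)
next
  case (Cons z ys)
  have card: "card (bottom_row k z (ys @ l)) = u"
    using Cons.prems(2) by simp
  show ?case
  proof (cases "meets_height k (z # ys @ l) (k + 1 - u)")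
    case True
    have "\<not> left_height k u (z # ys @ l) (k - u)"
      using not_left_height_if_meets_height[OF _ True, of "k - u"] Cons.prems(1) length_eq
        two_le_length by (simp add: card)
    then have "(z # ys) @ l = add_rows (length (z # ys)) d l"
      using append_eq_add_rows_lax[OF length_eq Cons.prems] by simp
    with True show ?thesis
      by (intro exI[of _ "length (z # ys)"] exI[of _ 0]) (simp add: add_phase_def)
  next
    case False
    obtain x y where phase_eq: "ys @ l = add_phase x y d l"
        "0 < x \<longrightarrow> meets_height k (add_rows x d l) (k + 1 - u)"
      using Cons by (auto dest: k_shape_ConsD)
    interpret phase: row_phase k "ys @ l" "phase_word x y d" u
      unfolding phase_eq(1) by (rule row_phase_add_phase)
    have "length (phase_word x y d) + u = k"
      using length_eq two_le_length by (simp add: phase_word_def length_merge_hd)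
    from phase.Cons_eq_add_row_strict[OF this card False]
    have "(z # ys) @ l = add_phase x (Suc y) d l"
      by (simp add: phase_eq(1) add_phase_def phase_word_def)
    with phase_eq(2) show ?thesis
      by blast
  qed
qed

lemma append_eq_add_phase_bounded:
  assumes "k_shape k (ys @ l)" "row_seq k (ys @ l) = replicate (length ys) u @ row_seq k l"
    and "irreducible_at k (ys @ l) u"
  shows "\<exists>x y. ys @ l = add_phase x y d l \<and> x < length d \<and> 0 < d ! x \<and> Suc y < length d"
proof -
  obtain x y where phase_eq: "ys @ l = add_phase x y d l"
    and meets: "0 < x \<longrightarrow> meets_height k (add_rows x d l) (k + 1 - u)"
    using append_eq_add_phase[OF assms(1,2)] by blast
  have lax: "step_count k (add_phase x y d l) u (k + 1 - u) < u"
    and strict: "step_count k (add_phase x y d l) u (k - u) < u"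
    using assms(3) by (simp_all add: irreducible_at_def phase_eq)
  have x_less: "x < length d"
    using lax sum_list_le_rotation_sum[of d x] sum_list_eq
    by (simp only: step_count_add_phase_lax) linarith
  have "y < length (merge_hd (rotate x d))"
    using strict sum_list_le_rotation_sum[of "merge_hd (rotate x d)" y] sum_list_eq
    by (simp only: step_count_add_phase_strict sum_list_merge_hd sum_list_rotate) linarith
  then have y_less: "Suc y < length d"
    using two_le_length by (simp add: length_merge_hd)
  have "0 < d ! x"
  proof (cases "x = 0")
    case True
    then show ?thesis
      using hd_pos nonempty by (simp add: hd_conv_nth)
  next
    case False
    then show ?thesis
      using hd_rotate_pos_if_meets_height[OF length_eq, of x] meets x_less by (simp add: hd_rotate)
  qed
  with phase_eq x_less y_less show ?thesis
    by blast
qed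

end

lemma row_seq_split:
  assumes "sorted_wrt (\<ge>) (row_seq k l)" "\<forall>r\<in>set (row_seq k l). r \<le> Suc u"
  shows "\<exists>ys l'. l = ys @ l' \<and> row_seq k l = replicate (length ys) (Suc u) @ row_seq k l' \<and>
    (\<forall>r\<in>set (row_seq k l'). r \<le> u)"
  using assms
proof (induction l)
  case (Cons x l)
  show ?case
  proof (cases "card (bottom_row k x l) = Suc u")
    case True
    obtain ys l' where "l = ys @ l'" "row_seq k l = replicate (length ys) (Suc u) @ row_seq k l'"
      "\<forall>r\<in>set (row_seq k l'). r \<le> u"
      using Cons by auto
    with True show ?thesis
      by (intro exI[of _ "x # ys"] exI[of _ l']) simp
  next
    case False
    with Cons.prems show ?thesis
      by (intro exI[of _ "[]"] exI[of _ "x # l"]) force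
  qed
qed simp

lemma step_count_append_shorter:
  "row_seq k (ys @ l) = replicate (length ys) u @ row_seq k l \<Longrightarrow> u' < u \<Longrightarrow> k \<le> u' + v \<Longrightarrow>
     step_count k (ys @ l) u' v = step_count k l u' v"
  by (induction ys) (simp_all add: step_count_Cons_shorter)

lemma row_seq_pos:
  assumes "is_partition l" "l \<noteq> []" "0 < k"
  shows "\<exists>r\<in>set (row_seq k l). 0 < r"
  using assms(2,1)
proof (induction l rule: list_nonempty_induct)
  case (single x)
  then have "x - 1 \<in> bottom_row k x []"
    using assms(3) by (auto simp: bottom_row_def is_partition_def)
  then have "0 < card (bottom_row k x [])"
    by (auto simp: card_gt_0_iff)
  then show ?case
    by simp
qed (auto simp: is_partition_def)

lemma ex_code:
  assumes "k_shape k l" "\<forall>r\<in>set (row_seq k l). r \<le> n" "n < k"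
    and "\<forall>u\<in>{1..n}. irreducible_at k l u"
  shows "\<exists>cs\<in>codes k n. code_shape k cs = l"
  using assms
proof (induction n arbitrary: l)
  case 0
  then have "l = []"
    using row_seq_pos[of l k] by (force simp: k_shape_iff)
  then show ?case
    by (simp add: codes_def)
next
  case (Suc n)
  obtain ys l' where split: "l = ys @ l'"
      "row_seq k l = replicate (length ys) (Suc n) @ row_seq k l'" "\<forall>r\<in>set (row_seq k l'). r \<le> n"
    using row_seq_split[of k l n] Suc.prems by (auto simp: k_shape_iff)
  have "irreducible_at k l' u \<longleftrightarrow> irreducible_at k l u" if "u \<in> {1..n}" for u
    using step_count_append_shorter[of k ys l' "Suc n" u] split that
    by (simp add: irreducible_at_def)
  then obtain cs where code: "cs \<in> codes k n" "code_shape k cs = l'"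
    using Suc.IH[of l'] Suc.prems split(3) k_shape_appendD[of k ys l'] by (auto simp: split(1))
  then have valid: "valid_code k cs" "length cs = n"
    by (simp_all add: codes_def)
  interpret column_profile k l' "code_word k cs"
    using column_profile_code[OF valid(1)] Suc.prems(3) by (auto simp: code(2))
  interpret full_phase k l' "incr_hd (code_word k cs)" "Suc n"
    using full_phase_incr_hd valid Suc.prems(3) split(3)
    by (auto simp: length_code_word sum_list_code_word)
  have "irreducible_at k (ys @ l') (Suc n)"
    using Suc.prems(4) by (simp add: split(1))
  then obtain x y where "ys @ l' = add_phase x y (incr_hd (code_word k cs)) l'"
    "x < length (code_word k cs)" "0 < incr_hd (code_word k cs) ! x"
    "Suc y < length (code_word k cs)"
    using append_eq_add_phase_bounded[of ys] Suc.prems(1) split(1,2) by auto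
  then show ?case
    using code valid by (intro bexI[of _ "(x, y) # cs"]) (simp_all add: codes_def split(1))
qed

lemma le_step_count_full_row:
  assumes "is_partition (x # l)" "card (bottom_row k x l) = k" "0 < k"
  shows "k \<le> step_count k (x # l) k 1"
proof -
  have zero: "col_ht k l j = 0" if "j \<in> bottom_row k x l" for j
  proof -
    have "x - k \<le> j"
      using that assms(2) mem_bottom_row_iff[of j k x l] by linarith
    then have "full_ht l j \<le> full_ht l (x - k)"
      by (rule full_ht_antimono)
    then show ?thesis
      using card_bottom_row_plus_full_ht_le[of k x l] col_ht_le_full_ht[of k l j] assms(2,3) by simp
  qed
  have "bottom_row k x l \<subseteq> {j. base_row_len k (x # l) j = k \<and> col_ht k (x # l) j = 1}"
    using assms(2) zero by auto
  from card_mono[OF finite_columns_of_height[OF assms(1)] this] show ?thesis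
    by (simp add: assms(2) step_count_def)
qed

lemma irreducible_row_seq_less:
  assumes "l \<in> irreducible_k_shapes k" "r \<in> set (row_seq k l)" "0 < k"
  shows "r < k"
proof (cases l)
  case (Cons x l')
  have sorted: "sorted_wrt (\<ge>) (row_seq k l)" and partition: "is_partition l"
    using assms(1) by (simp_all add: irreducible_k_shapes_iff k_shape_iff)
  have "step_count k l k 1 < k"
    using assms(1,3)
    by (auto simp: irreducible_k_shapes_iff irreducible_at_def dest!: bspec[of _ _ k])
  then have "card (bottom_row k x l') \<noteq> k"
    using le_step_count_full_row[of x l' k] partition assms(3) by (auto simp: Cons)
  then have "card (bottom_row k x l') < k"
    using card_bottom_row_le_k[of k x l'] by simp
  then show ?thesis
    using sorted assms(2) by (auto simp: Cons)
qed (use assms in simp)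

lemma bij_betw_code_shape:
  assumes "0 < k"
  shows "bij_betw (code_shape k) (codes k (k - 1)) (irreducible_k_shapes k)"
  unfolding bij_betw_def
proof (intro conjI inj_on_code_shape equalityI subsetI)
  fix l
  assume irreducible: "l \<in> irreducible_k_shapes k"
  have "\<exists>cs\<in>codes k (k - 1). code_shape k cs = l"
    using irreducible irreducible_row_seq_less[OF irreducible _ assms] assms
    by (intro ex_code) (fastforce simp: irreducible_k_shapes_iff)+
  then show "l \<in> code_shape k ` codes k (k - 1)"
    by blast
qed (use code_shape_irreducible assms in auto)

lemma free_site_iff_step_count:
  assumes "k_shape k l" "i < k"
  shows "free_site k l i \<longleftrightarrow> step_count k l (k - i) (i + 1) = 0"
proof -
  let ?S = "{j. base_row_len k l j = k - i \<and> col_ht k l j = i + 1}"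
  have base: "base_row_len k l j = k - i"
    if cell: "(r, j) \<in> k_boundary k l" and row: "row_len k l r = k - i"
      and col: "col_ht k l j = i + 1" for r j
  proof -
    obtain r' where lowest: "(r', j) \<in> k_boundary k l" "\<forall>r''<r'. (r'', j) \<notin> k_boundary k l"
      using exists_least_iff[of "\<lambda>r. (r, j) \<in> k_boundary k l"] cell by blast
    have "r' \<le> r" "r < length l"
      using lowest cell by (auto simp: not_less[symmetric] k_boundary_def diagram_def)
    moreover have "\<forall>r r'. r' < r \<longrightarrow> r < length l \<longrightarrow> row_len k l r \<le> row_len k l r'"
      using assms(1) by (auto simp: k_shape_def row_seq_def sorted_wrt_iff_nth_less)
    ultimately have "k - i \<le> row_len k l r'"
      using row by (metis le_neq_implies_less order_refl)
    moreover have "base_row_len k l j = row_len k l r'"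
      using lowest calculation assms(2) by (subst base_row_len_eq_iff) (auto simp: h_steps_def)
    ultimately show ?thesis
      using col base_row_len_plus_col_ht_le[of k l j] by linarith
  qed
  have "H_cells k l (k - i) \<inter> V_cells k l (i + 1) = {} \<longleftrightarrow> ?S = {}"
  proof
    assume empty: "H_cells k l (k - i) \<inter> V_cells k l (i + 1) = {}"
    have "\<exists>r. (r, j) \<in> k_boundary k l \<and> row_len k l r = k - i" if "base_row_len k l j = k - i" for j
      using that base_row_len_eq_iff[of "k - i" k l j] assms(2) by (auto simp: h_steps_def)
    with empty show "?S = {}"
      by (fastforce simp: H_cells_def V_cells_def)
  qed (use base in \<open>auto simp: H_cells_def V_cells_def\<close>)
  moreover have "finite ?S"
    using assms(1) by (auto simp: k_shape_def intro: finite_columns_of_height)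
  ultimately show ?thesis
    by (simp add: free_site_def step_count_def)
qed

lemma free_site_code_shape:
  assumes "cs \<in> codes k (k - 1)" "1 \<le> i" "i < k - 1"
  shows "free_site k (code_shape k cs) i \<longleftrightarrow> fst (cs ! (i - 1)) = 0"
proof -
  have valid: "valid_code k cs" "length cs = k - 1"
    using assms(1) by (simp_all add: codes_def)
  have "k_shape k (code_shape k cs)"
    using code_shape_irreducible[OF assms(1)] assms(3) by (simp add: irreducible_k_shapes_iff)
  moreover have "length cs - (i - 1) = k - i" "k + 1 - (k - i) = i + 1" "i - 1 < length cs"
    using assms(2,3) valid(2) by auto
  ultimately show ?thesis
    using step_count_code_eq_0_iff[OF valid(1), of "i - 1"] free_site_iff_step_count[of k _ i]
      assms(3) by simp
qed

section \<open>Counting surjective pistols\<close>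

definition odd_step :: "(nat \<Rightarrow> nat) \<Rightarrow> nat \<Rightarrow> nat" where
  "odd_step v m = m * (v m + v (Suc m))"

definition even_step :: "bool \<Rightarrow> (nat \<Rightarrow> nat) \<Rightarrow> nat \<Rightarrow> nat" where
  "even_step t v m = (if t then 1 else m - 1) * (v m + v (m - 1))"

fun refined_count :: "bool list \<Rightarrow> nat \<Rightarrow> nat" where
  "refined_count [] = (\<lambda>m. if m = 0 then 1 else 0)"
| "refined_count (t # ts) = odd_step (even_step t (refined_count ts))"

lemma refined_count_True: "refined_count [True] = (\<lambda>m. if m = 1 then 1 else 0)"
  by (auto simp: fun_eq_iff odd_step_def even_step_def)

definition marked_subsets :: "'a set \<Rightarrow> 'a \<Rightarrow> nat \<Rightarrow> 'a set set" where
  "marked_subsets V z m = {U. U \<subseteq> V \<and> z \<in> U \<and> card U = m}"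

lemma finite_marked_subsets: "finite V \<Longrightarrow> finite (marked_subsets V z m)"
  by (simp add: marked_subsets_def)

lemma sum_marked_subsets_insert_outside:
  fixes F :: "'a set \<Rightarrow> 'b :: comm_semiring_1"
  assumes "finite V"
  shows "(\<Sum>U\<in>marked_subsets V z m. \<Sum>v\<in>V - U. F (insert v U)) =
    of_nat m * (\<Sum>U\<in>marked_subsets V z (Suc m). F U)"
proof -
  have "(\<Sum>U\<in>marked_subsets V z m. \<Sum>v\<in>V - U. F (insert v U)) =
      (\<Sum>(U, v)\<in>(SIGMA U:marked_subsets V z m. V - U). F (insert v U))"
    using assms by (intro sum.Sigma) (auto intro: finite_marked_subsets)
  also have "\<dots> = (\<Sum>(U, v)\<in>(SIGMA U:marked_subsets V z (Suc m). U - {z}). F U)"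
    using assms
    by (intro sum.reindex_bij_witness[of _ "\<lambda>(U, v). (U - {v}, v)" "\<lambda>(U, v). (insert v U, v)"])
      (auto simp: marked_subsets_def card_insert_if card_Diff_singleton_if insert_absorb
        dest: finite_subset)
  also have "\<dots> = (\<Sum>U\<in>marked_subsets V z (Suc m). \<Sum>v\<in>U - {z}. F U)"
    using assms finite_marked_subsets[OF assms, of z "Suc m"]
    by (intro sum.Sigma[symmetric]) (auto simp: marked_subsets_def intro: finite_subset)
  also have "\<dots> = of_nat m * (\<Sum>U\<in>marked_subsets V z (Suc m). F U)"
    by (auto simp: sum_distrib_left marked_subsets_def card_Diff_singleton intro!: sum.cong)
  finally show ?thesis .
qed

lemma sum_marked_subsets_insert:
  fixes F :: "'a set \<Rightarrow> nat"
  assumes "finite V"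
  shows "(\<Sum>U\<in>marked_subsets V z m. \<Sum>v\<in>V. F (insert v U)) =
    odd_step (\<lambda>m. \<Sum>U\<in>marked_subsets V z m. F U) m"
proof -
  have "(\<Sum>v\<in>V. F (insert v U)) = m * F U + (\<Sum>v\<in>V - U. F (insert v U))"
    if "U \<in> marked_subsets V z m" for U
  proof -
    have "U \<subseteq> V" "card U = m"
      using that by (auto simp: marked_subsets_def)
    then have "(\<Sum>v\<in>V. F (insert v U)) = (\<Sum>v\<in>V - U. F (insert v U)) + (\<Sum>v\<in>U. F (insert v U))"
      by (intro sum.subset_diff assms)
    then show ?thesis
      using \<open>card U = m\<close> by (simp add: insert_absorb)
  qed
  then have "(\<Sum>U\<in>marked_subsets V z m. \<Sum>v\<in>V. F (insert v U)) =
      m * (\<Sum>U\<in>marked_subsets V z m. F U) + (\<Sum>U\<in>marked_subsets V z m. \<Sum>v\<in>V - U. F (insert v U))"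
    by (simp add: sum.distrib sum_distrib_left)
  then show ?thesis
    by (simp add: sum_marked_subsets_insert_outside[OF assms] odd_step_def distrib_left)
qed

lemma marked_subsets_insert:
  assumes "finite V" "a \<notin> V" "a \<noteq> z"
  shows "marked_subsets (insert a V) z m =
    marked_subsets V z m \<union> insert a ` marked_subsets V z (m - 1)"
proof (intro equalityI subsetI)
  fix U
  assume U_mem: "U \<in> marked_subsets (insert a V) z m"
  show "U \<in> marked_subsets V z m \<union> insert a ` marked_subsets V z (m - 1)"
  proof (cases "a \<in> U")
    case True
    then have "U - {a} \<in> marked_subsets V z (m - 1)" "U = insert a (U - {a})"
      using U_mem assms by (auto simp: marked_subsets_def card_Diff_singleton)
    then show ?thesis
      by blast
  qed (use U_mem in \<open>auto simp: marked_subsets_def\<close>)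
next
  fix U
  assume U_mem: "U \<in> marked_subsets V z m \<union> insert a ` marked_subsets V z (m - 1)"
  have "insert a W \<in> marked_subsets (insert a V) z m"
    if W_mem: "W \<in> marked_subsets V z (m - 1)" for W
  proof -
    have "finite W" "a \<notin> W" "W \<noteq> {}" "card W = m - 1"
      using W_mem assms by (auto simp: marked_subsets_def dest: finite_subset)
    then have "card (insert a W) = m"
      using card_gt_0_iff[of W] by simp
    with W_mem show ?thesis
      by (auto simp: marked_subsets_def)
  qed
  with U_mem show "U \<in> marked_subsets (insert a V) z m"
    by (auto simp: marked_subsets_def)
qed

lemma sum_marked_subsets_of_insert:
  assumes "finite V" "a \<notin> V" "a \<noteq> z"
  shows "(\<Sum>U\<in>marked_subsets (insert a V) z m. F U) =
    (\<Sum>U\<in>marked_subsets V z m. F U) + (\<Sum>U\<in>marked_subsets V z (m - 1). F (insert a U))"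
proof -
  have "inj_on (insert a) (marked_subsets V z (m - 1))"
    using assms(2) by (auto simp: inj_on_def marked_subsets_def)
  moreover have "marked_subsets V z m \<inter> insert a ` marked_subsets V z (m - 1) = {}"
    using assms(2) by (auto simp: marked_subsets_def)
  ultimately show ?thesis
    using assms(1) unfolding marked_subsets_insert[OF assms]
    by (simp add: sum.union_disjoint finite_marked_subsets sum.reindex)
qed

definition evens :: "nat \<Rightarrow> nat \<Rightarrow> nat set" where
  "evens n y = {v \<in> {y..2*n}. even v}"

text \<open>The right ends, from position \<open>y\<close> on, of the surjective pistols of height \<open>n\<close> that take the
  values \<open>U\<close> before \<open>y\<close>; the fixed points below \<open>2 * n\<close> are prescribed by \<open>t\<close>.\<close>

definition completions :: "nat \<Rightarrow> (nat \<Rightarrow> bool) \<Rightarrow> nat \<Rightarrow> nat set \<Rightarrow> (nat \<Rightarrow> nat) set" where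
  "completions n t y U = {g \<in> Pi\<^sub>E {y..2*n} (evens n).
     evens n y \<subseteq> U \<union> g ` {y..2*n} \<and> (\<forall>i<n. y \<le> 2*i \<longrightarrow> (g (2*i) = 2*i \<longleftrightarrow> t i))}"

definition admissible_values :: "nat \<Rightarrow> (nat \<Rightarrow> bool) \<Rightarrow> nat \<Rightarrow> nat set \<Rightarrow> nat set" where
  "admissible_values n t y U =
     (if odd y then evens n (Suc y)
      else if t (y div 2) then {y}
      else if y \<in> U then evens n (Suc y) else {})"

lemma finite_evens [simp]: "finite (evens n y)"
  by (simp add: evens_def)

lemma finite_completions [simp]: "finite (completions n t y U)"
  by (simp add: completions_def finite_PiE)

lemma evens_odd: "odd y \<Longrightarrow> evens n y = evens n (Suc y)"
  by (auto simp: evens_def Suc_le_eq le_less)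

lemma evens_even: "even y \<Longrightarrow> y \<le> 2 * n \<Longrightarrow> evens n y = insert y (evens n (Suc y))"
  by (auto simp: evens_def Suc_le_eq le_less)

lemma completions_insert_outside:
  "a \<notin> evens n y \<Longrightarrow> completions n t y (insert a U) = completions n t y U"
  by (auto simp: completions_def)

lemma all_le_double_iff:
  assumes "y < 2 * n"
  shows "(\<forall>i<n. y \<le> 2*i \<longrightarrow> P i) \<longleftrightarrow>
    (even y \<longrightarrow> P (y div 2)) \<and> (\<forall>i<n. Suc y \<le> 2*i \<longrightarrow> P i)"
proof -
  have "y \<le> 2*i \<longleftrightarrow> even y \<and> i = y div 2 \<or> Suc y \<le> 2*i" for i
    by presburger
  then show ?thesis
    using assms by auto
qed

lemma fun_upd_mem_completions_iff:
  assumes y_less: "y < 2 * n" and h_mem: "h \<in> Pi\<^sub>E {Suc y..2*n} (evens n)"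
    and v_mem: "v \<in> evens n y"
  shows "h(y := v) \<in> completions n t y U \<longleftrightarrow>
    v \<in> admissible_values n t y U \<and> h \<in> completions n t (Suc y) (insert v U)"
proof -
  have domain: "{y..2*n} = insert y {Suc y..2*n}"
    using y_less by auto
  have upd_mem: "h(y := v) \<in> Pi\<^sub>E {y..2*n} (evens n)"
    unfolding domain by (rule PiE_fun_upd[OF v_mem h_mem])
  have image: "h(y := v) ` {y..2*n} = insert v (h ` {Suc y..2*n})"
    unfolding domain by auto
  have flags: "(\<forall>i<n. y \<le> 2*i \<longrightarrow> ((h(y := v)) (2*i) = 2*i \<longleftrightarrow> t i)) \<longleftrightarrow>
      (even y \<longrightarrow> (v = y \<longleftrightarrow> t (y div 2))) \<and> (\<forall>i<n. Suc y \<le> 2*i \<longrightarrow> (h (2*i) = 2*i \<longleftrightarrow> t i))"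
    unfolding all_le_double_iff[OF y_less] by auto
  note unfold_completions = completions_def mem_Collect_eq image flags
  show ?thesis
  proof (cases "even y")
    case True
    have "y \<notin> h ` {Suc y..2*n}"
      using PiE_mem[OF h_mem] by (fastforce simp: evens_def)
    then have "evens n y \<subseteq> U \<union> insert v (h ` {Suc y..2*n}) \<longleftrightarrow>
        (y \<in> U \<or> v = y) \<and> evens n (Suc y) \<subseteq> insert v U \<union> h ` {Suc y..2*n}"
      using evens_even[OF True, of n] y_less by auto
    moreover have "v \<in> admissible_values n t y U \<longleftrightarrow> (y \<in> U \<or> v = y) \<and> (v = y \<longleftrightarrow> t (y div 2))"
      using v_mem True y_less
      by (auto simp: admissible_values_def evens_even) (auto simp: evens_def)
    ultimately show ?thesis
      using upd_mem h_mem True by (simp only: unfold_completions) blast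
  next
    case False
    then have "v \<in> admissible_values n t y U"
      using v_mem evens_odd by (simp add: admissible_values_def)
    then show ?thesis
      using upd_mem h_mem by (simp only: unfold_completions evens_odd[OF False]) (simp add: False)
  qed
qed

lemma card_completions_rec:
  assumes "y < 2 * n"
  shows "card (completions n t y U) =
    (\<Sum>v\<in>admissible_values n t y U. card (completions n t (Suc y) (insert v U)))"
proof -
  let ?S = "SIGMA v:admissible_values n t y U. completions n t (Suc y) (insert v U)"
  let ?P = "evens n y \<times> Pi\<^sub>E {Suc y..2*n} (evens n)"
  let ?upd = "\<lambda>(v, h). h(y := v)"
  have admissible_subset: "admissible_values n t y U \<subseteq> evens n y"
    using assms by (simp add: admissible_values_def evens_odd evens_even subset_insertI)
  have completions_subset: "completions n t x W \<subseteq> Pi\<^sub>E {x..2*n} (evens n)" for x W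
    unfolding completions_def by (rule Collect_subset)
  have Sigma_eq: "?S = {p \<in> ?P. ?upd p \<in> completions n t y U}"
  proof (rule set_eqI)
    fix p :: "nat \<times> (nat \<Rightarrow> nat)"
    obtain v h where "p = (v, h)"
      by (cases p)
    then show "p \<in> ?S \<longleftrightarrow> p \<in> {p \<in> ?P. ?upd p \<in> completions n t y U}"
      using fun_upd_mem_completions_iff[OF assms, of h v t U] admissible_subset completions_subset
      by (simp add: mem_Times_iff) blast
  qed
  have "{y..2*n} = insert y {Suc y..2*n}"
    using assms by auto
  then have "completions n t y U \<subseteq> ?upd ` ?P"
    using completions_subset unfolding PiE_insert_eq[symmetric] by metis
  then have "completions n t y U = ?upd ` ?S"
    unfolding Sigma_eq by blast
  moreover have "inj_on ?upd ?S"
    unfolding Sigma_eq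
    by (rule inj_on_subset[OF inj_combinator[of y "{Suc y..2*n}" "evens n"]]) auto
  moreover have "finite (admissible_values n t y U)"
    by (rule finite_subset[OF admissible_subset]) simp
  ultimately show ?thesis
    by (simp add: card_image)
qed

text \<open>Every pistol of height \<open>n\<close> takes the value \<open>2 * n\<close> at \<open>2 * n\<close>, so this value can be
  counted as taken from the outset.\<close>

definition completion_count :: "nat \<Rightarrow> (nat \<Rightarrow> bool) \<Rightarrow> nat \<Rightarrow> nat \<Rightarrow> nat" where
  "completion_count n t y =
     (\<lambda>m. \<Sum>U\<in>marked_subsets (evens n y) (2*n) m. card (completions n t y U))"

lemma completion_count_odd:
  assumes "odd y" "y < 2 * n"
  shows "completion_count n t y = odd_step (completion_count n t (Suc y))"
proof
  fix m
  let ?c = "\<lambda>U. card (completions n t (Suc y) U)"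
  have "card (completions n t y U) = (\<Sum>v\<in>evens n (Suc y). ?c (insert v U))" for U
    using assms by (simp add: card_completions_rec admissible_values_def)
  then show "completion_count n t y m = odd_step (completion_count n t (Suc y)) m"
    using sum_marked_subsets_insert[of "evens n (Suc y)" ?c "2*n" m]
    by (simp add: completion_count_def evens_odd[OF assms(1)])
qed

lemma completion_count_even_split:
  assumes "even y" "y < 2 * n"
  shows "completion_count n t y m =
    (\<Sum>U\<in>marked_subsets (evens n (Suc y)) (2*n) m. card (completions n t y U)) +
    (\<Sum>U\<in>marked_subsets (evens n (Suc y)) (2*n) (m - 1). card (completions n t y (insert y U)))"
proof -
  have "y \<notin> evens n (Suc y)"
    by (simp add: evens_def)
  then show ?thesis
    using assms unfolding completion_count_def
    by (simp add: evens_even sum_marked_subsets_of_insert)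
qed

lemma completion_count_even:
  assumes "even y" "y < 2 * n"
  shows "completion_count n t y = even_step (t (y div 2)) (completion_count n t (Suc y))"
proof
  fix m
  let ?E = "evens n (Suc y)"
  let ?c = "\<lambda>U. card (completions n t (Suc y) U)"
  note rec = completion_count_even_split[OF assms] card_completions_rec[OF assms(2)]
  have y_notin: "y \<notin> ?E"
    by (simp add: evens_def)
  have insert_y: "completions n t (Suc y) (insert y U) = completions n t (Suc y) U" for U
    by (rule completions_insert_outside[OF y_notin])
  show "completion_count n t y m = even_step (t (y div 2)) (completion_count n t (Suc y)) m"
  proof (cases "t (y div 2)")
    case True
    then have "card (completions n t y U) = ?c U" for U
      using assms rec(2) by (simp add: admissible_values_def insert_y)
    then show ?thesis
      using True by (simp add: rec(1) even_step_def completion_count_def[of n t "Suc y"] insert_y)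
  next
    case False
    have "card (completions n t y U) = 0" if "U \<in> marked_subsets ?E (2*n) m" for U
    proof -
      have "y \<notin> U"
        using that y_notin by (auto simp: marked_subsets_def)
      then show ?thesis
        using False assms rec(2) by (simp add: admissible_values_def)
    qed
    moreover have "card (completions n t y (insert y U)) = (\<Sum>v\<in>?E. ?c (insert v U))" for U
      using False assms rec(2) by (simp add: admissible_values_def insert_commute[of _ y] insert_y)
    ultimately have "completion_count n t y m = odd_step (completion_count n t (Suc y)) (m - 1)"
      using sum_marked_subsets_insert[of ?E ?c "2*n" "m - 1"]
      by (simp add: rec(1) completion_count_def[of n t "Suc y"])
    also have "\<dots> = even_step False (completion_count n t (Suc y)) m"
      by (cases m) (simp_all add: odd_step_def even_step_def)
    finally show ?thesis
      using False by simp
  qed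
qed

lemma completion_count_top:
  assumes "0 < n"
  shows "completion_count n t (2*n) = (\<lambda>m. if m = 1 then 1 else 0)"
proof
  fix m
  have evens: "evens n (2*n) = {2*n}"
    by (auto simp: evens_def)
  have "marked_subsets {2*n} (2*n) m = (if m = 1 then {{2*n}} else {})"
    by (auto simp: marked_subsets_def subset_singleton_iff)
  moreover have "completions n t (2*n) {2*n} = {2*n} \<rightarrow>\<^sub>E {2*n}"
    by (auto simp: completions_def evens PiE_iff extensional_def)
  ultimately show "completion_count n t (2*n) m = (if m = 1 then 1 else 0)"
    by (simp add: completion_count_def evens card_PiE)
qed

lemma completion_count_eq_refined_count:
  "i < n \<Longrightarrow> completion_count n t (2*i + 1) = refined_count (map t [Suc i..<n] @ [True])"
proof (induction "n - i" arbitrary: i)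
  case (Suc d)
  show ?case
  proof (cases "Suc i < n")
    case True
    then have "completion_count n t (2*i + 1) =
        odd_step (even_step (t (Suc i)) (completion_count n t (2 * Suc i + 1)))"
      by (simp add: completion_count_odd completion_count_even)
    also have "completion_count n t (2 * Suc i + 1) =
        refined_count (map t [Suc (Suc i)..<n] @ [True])"
      using Suc.hyps(1)[of "Suc i"] Suc.hyps(2) True by simp
    finally show ?thesis
      using True by (simp add: upt_conv_Cons)
  next
    case False
    then have "n = Suc i"
      using Suc.prems by simp
    then show ?thesis
      using completion_count_top[of n t] refined_count_True
      by (auto simp: completion_count_odd odd_step_def)
  qed
qed simp

lemma surj_pistols_eq_completions:
  assumes "0 < n"
  shows "{f \<in> surj_pistols n. \<forall>i\<in>{1..<n}. f (2*i) = 2*i \<longleftrightarrow> t i} = completions n t 1 {2*n}"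
proof (rule set_eqI)
  fix f
  let ?V = "(\<lambda>i. 2*i) ` {1..n}"
  have mem_evens_iff: "v \<in> evens n y \<longleftrightarrow> v \<in> ?V \<and> y \<le> v" if "0 < y" for v y
    using that by (auto simp: evens_def elim!: evenE)
  have mem_PiE_iff: "f \<in> Pi\<^sub>E {1..2*n} (evens n) \<longleftrightarrow> f \<in> {1..2*n} \<rightarrow>\<^sub>E ?V \<and> (\<forall>y\<in>{1..2*n}. y \<le> f y)"
    by (simp add: PiE_iff mem_evens_iff ball_conj_distrib conj_ac cong: conj_cong)
  have "evens n 1 \<subseteq> {2*n} \<union> f ` {1..2*n} \<longleftrightarrow> f ` {1..2*n} = ?V"
    if f_mem: "f \<in> Pi\<^sub>E {1..2*n} (evens n)"
  proof -
    have "f (2*n) \<in> evens n (2*n)"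
      using assms by (intro PiE_mem[OF f_mem]) simp
    then have "2*n \<in> f ` {1..2*n}"
      using assms by (intro image_eqI[of _ _ "2*n"]) (simp_all add: evens_def)
    moreover have "f ` {1..2*n} \<subseteq> ?V"
      using PiE_mem[OF f_mem] mem_evens_iff by (intro image_subsetI) auto
    moreover have "evens n 1 = ?V"
      by (intro set_eqI) (auto simp: mem_evens_iff)
    ultimately show ?thesis
      by (metis insert_absorb insert_is_Un order_refl subset_antisym)
  qed
  moreover have "(\<forall>i<n. 1 \<le> 2*i \<longrightarrow> (f (2*i) = 2*i \<longleftrightarrow> t i)) \<longleftrightarrow>
      (\<forall>i\<in>{1..<n}. f (2*i) = 2*i \<longleftrightarrow> t i)"
    by auto
  ultimately show "f \<in> {f \<in> surj_pistols n. \<forall>i\<in>{1..<n}. f (2*i) = 2*i \<longleftrightarrow> t i} \<longleftrightarrow>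
      f \<in> completions n t 1 {2*n}"
    unfolding surj_pistols_def completions_def mem_Collect_eq using mem_PiE_iff by blast
qed

lemma card_surj_pistols:
  assumes "0 < n"
  shows "card {f \<in> surj_pistols n. \<forall>i\<in>{1..<n}. f (2*i) = 2*i \<longleftrightarrow> t i} =
    refined_count (map t [1..<n] @ [True]) 1"
proof -
  have "marked_subsets (evens n 1) (2*n) 1 = {{2*n}}"
    using assms by (auto simp: marked_subsets_def evens_def card_1_singleton_iff)
  then have "card (completions n t 1 {2*n}) = completion_count n t 1 1"
    by (simp add: completion_count_def)
  also have "\<dots> = refined_count (map t [1..<n] @ [True]) 1"
    using completion_count_eq_refined_count[OF assms, of t] by simp
  finally show ?thesis
    unfolding surj_pistols_eq_completions[OF assms] .
qed

section \<open>Counting codes\<close>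

lemma card_rotations_hd: "card {x. x < length b \<and> hd (rotate x b)} = count_list b True"
proof -
  have "{x. x < length b \<and> hd (rotate x b)} = {x. x < length b \<and> True = b ! x}"
    by (auto simp: hd_rotate)
  then show ?thesis
    by (simp only: count_list_eq_length_filter length_filter_conv_card)
qed

lemma card_rotations_hd_flag:
  assumes "b \<noteq> []" "hd b"
  shows "card {x. x < length b \<and> (x = 0 \<longleftrightarrow> t) \<and> hd (rotate x b)} =
    (if t then 1 else count_list b True - 1)"
proof (cases t)
  case True
  then have "{x. x < length b \<and> (x = 0 \<longleftrightarrow> t) \<and> hd (rotate x b)} = {0}"
    using assms by auto
  then show ?thesis
    using True by simp
next
  case False
  then have "{x. x < length b \<and> (x = 0 \<longleftrightarrow> t) \<and> hd (rotate x b)} =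
      {x. x < length b \<and> hd (rotate x b)} - {0}"
    by auto
  then show ?thesis
    using False assms card_rotations_hd[of b] by (simp add: card_Diff_singleton)
qed

lemma card_rotate_True_tl_fibre:
  assumes "finite S" "\<And>s. s \<in> S \<Longrightarrow> length (p s) = length q" "q \<noteq> []" "I \<subseteq> {..<length q}"
    and closed: "\<And>x. x \<in> I \<Longrightarrow> (length q - x) mod length q \<in> I"
    and fibres: "\<And>r. Suc (length r) = length q \<Longrightarrow> Suc (count_list r True) = count_list q True \<Longrightarrow>
      card {s \<in> S. p s = True # r} + card {s \<in> S. p s = False # r} = c"
  shows "card {(x, s). x \<in> I \<and> s \<in> S \<and> rotate x (True # tl (p s)) = q} =
    card {x \<in> I. hd (rotate x q)} * c"
proof -
  have nonempty: "p s \<noteq> []" if "s \<in> S" for s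
    using assms(2)[OF that] assms(3) by auto
  have fibre: "card {s \<in> S. True # tl (p s) = rotate x q} = (if hd (rotate x q) then c else 0)"
    for x
  proof -
    obtain h r where rotate_eq: "rotate x q = h # r"
      using assms(3) by (cases "rotate x q") auto
    show ?thesis
    proof (cases h)
      case True
      have "tl (p s) = r \<longleftrightarrow> p s = True # r \<or> p s = False # r" if "s \<in> S" for s
        using nonempty[OF that] by (cases "p s") auto
      then have "{s \<in> S. True # tl (p s) = rotate x q} =
          {s \<in> S. p s = True # r} \<union> {s \<in> S. p s = False # r}"
        by (auto simp: rotate_eq True)
      moreover have "Suc (length r) = length q" "Suc (count_list r True) = count_list q True"
        using length_rotate[of x q] count_list_rotate[of x q True] by (simp_all add: rotate_eq True)
      ultimately show ?thesis
        using fibres[of r] assms(1) by (simp add: rotate_eq True card_Un_disjoint disjoint_iff)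
    qed (simp add: rotate_eq)
  qed
  have "card {(x, s). x \<in> I \<and> s \<in> S \<and> rotate x (True # tl (p s)) = q} =
      (\<Sum>x\<in>I. card {s \<in> S. True # tl (p s) = rotate x q})"
    using assms(1-4) closed nonempty by (intro card_rotate_fibre) auto
  also have "\<dots> = card {x \<in> I. hd (rotate x q)} * c"
    using finite_subset[OF assms(4)] by (simp add: fibre sum.If_cases Int_def)
  finally show ?thesis .
qed

text \<open>In the next two lemmas \<open>p\<close> stands for the occupancy pattern of a word.\<close>

lemma card_fibre_add_column:
  assumes "finite S" "\<And>s. s \<in> S \<Longrightarrow> length (p s) = length q"
    and fibre: "\<And>r. length r = length q \<Longrightarrow> card {s \<in> S. p s = r} = v (count_list r True)"
    and "q \<noteq> []" "hd q"
  shows "card {(x, s). x < length q \<and> (x = 0 \<longleftrightarrow> t) \<and> s \<in> S \<and> rotate x (True # tl (p s)) = q} =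
    even_step t v (count_list q True)"
proof -
  let ?I = "{x. x < length q \<and> (x = 0 \<longleftrightarrow> t)}" and ?m = "count_list q True"
  have "card {(x, s). x \<in> ?I \<and> s \<in> S \<and> rotate x (True # tl (p s)) = q} =
      card {x \<in> ?I. hd (rotate x q)} * (v ?m + v (?m - 1))"
    using assms(1,2,4)
  proof (rule card_rotate_True_tl_fibre)
    show "card {s \<in> S. p s = True # r} + card {s \<in> S. p s = False # r} = v ?m + v (?m - 1)"
      if "Suc (length r) = length q" "Suc (count_list r True) = ?m" for r
      using that(1) fibre[of "True # r"] fibre[of "False # r"] by (simp flip: that(2))
  qed (auto simp: mod_if)
  then show ?thesis
    using card_rotations_hd_flag[OF assms(4,5), of t] by (simp add: even_step_def conj_assoc)
qed

lemma card_fibre_merge: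
  assumes "finite S" "\<And>s. s \<in> S \<Longrightarrow> length (p s) = Suc (length q)" "\<And>s. s \<in> S \<Longrightarrow> hd (p s)"
    and fibre: "\<And>r. length r = Suc (length q) \<Longrightarrow> hd r \<Longrightarrow>
      card {s \<in> S. p s = r} = v (count_list r True)"
    and "q \<noteq> []"
  shows "card {(y, s). y < length q \<and> s \<in> S \<and> rotate y (True # tl (tl (p s))) = q} =
    odd_step v (count_list q True)"
proof -
  let ?m = "count_list q True"
  have p_eq: "p s = True # tl (p s)" if "s \<in> S" for s
    using assms(2,3)[OF that] by (cases "p s") auto
  have tl_fibre: "{s \<in> S. tl (p s) = r} = {s \<in> S. p s = True # r}" for r
    using p_eq by (metis list.sel(3))
  have "card {(y, s). y \<in> {..<length q} \<and> s \<in> S \<and> rotate y (True # tl (tl (p s))) = q} =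
      card {y \<in> {..<length q}. hd (rotate y q)} * (v (Suc ?m) + v ?m)"
  proof (rule card_rotate_True_tl_fibre)
    show "card {s \<in> S. tl (p s) = True # r} + card {s \<in> S. tl (p s) = False # r} =
        v (Suc ?m) + v ?m"
      if "Suc (length r) = length q" "Suc (count_list r True) = ?m" for r
      using that fibre[of "True # True # r"] fibre[of "True # False # r"] by (simp add: tl_fibre)
  qed (use assms in auto)
  then show ?thesis
    using card_rotations_hd[of q] by (simp add: odd_step_def add.commute)
qed

definition occupied :: "nat list \<Rightarrow> bool list" where
  "occupied d = map (\<lambda>a. 0 < a) d"

lemma length_occupied [simp]: "length (occupied d) = length d"
  by (simp add: occupied_def)

lemma occupied_rotate: "occupied (rotate n d) = rotate n (occupied d)"
  by (simp add: occupied_def rotate_map)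

lemma occupied_incr_hd: "d \<noteq> [] \<Longrightarrow> occupied (incr_hd d) = True # tl (occupied d)"
  by (cases d) (auto simp: occupied_def)

lemma occupied_merge_hd:
  "2 \<le> length d \<Longrightarrow> hd (occupied d) \<Longrightarrow> occupied (merge_hd d) = True # tl (tl (occupied d))"
  by (cases d rule: merge_hd.cases) (auto simp: occupied_def)

definition merge_pattern :: "nat \<Rightarrow> nat \<times> (nat \<times> nat) list \<Rightarrow> bool list" where
  "merge_pattern k = (\<lambda>(x, cs). rotate x (True # tl (occupied (code_word k cs))))"

lemma merge_pattern_eq:
  "code_word k cs \<noteq> [] \<Longrightarrow> merge_pattern k (x, cs) = occupied (rotate x (incr_hd (code_word k cs)))"
  by (simp add: merge_pattern_def occupied_rotate occupied_incr_hd)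

lemma valid_code_Cons_iff:
  "valid_code k ((x, y) # cs) \<longleftrightarrow> valid_code k cs \<and>
     x < length (code_word k cs) \<and> hd (merge_pattern k (x, cs)) \<and> Suc y < length (code_word k cs)"
proof (cases "x < length (code_word k cs)")
  case True
  then have "hd (merge_pattern k (x, cs)) \<longleftrightarrow> occupied (incr_hd (code_word k cs)) ! x"
    by (subst merge_pattern_eq) (auto simp: occupied_rotate hd_rotate)
  with True show ?thesis
    by (simp add: occupied_def)
qed simp

lemma occupied_code_word_Cons:
  assumes "valid_code k ((x, y) # cs)"
  shows "occupied (code_word k ((x, y) # cs)) = rotate y (True # tl (tl (merge_pattern k (x, cs))))"
proof -
  have "code_word k cs \<noteq> []" "2 \<le> length (code_word k cs)" "hd (merge_pattern k (x, cs))"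
    using assms unfolding valid_code_Cons_iff by auto
  then show ?thesis
    by (simp add: phase_word_def occupied_rotate occupied_merge_hd merge_pattern_eq)
qed

definition flagged_codes :: "nat \<Rightarrow> bool list \<Rightarrow> (nat \<times> nat) list set" where
  "flagged_codes k ts = {cs. valid_code k cs \<and> map (\<lambda>c. fst c = 0) cs = ts}"

lemma length_flagged_codes: "cs \<in> flagged_codes k ts \<Longrightarrow> length cs = length ts"
  by (auto simp: flagged_codes_def)

lemma finite_codes: "finite (codes k n)"
proof (rule finite_subset)
  have "valid_code k cs \<Longrightarrow> set cs \<subseteq> {..<k} \<times> {..<k}" for cs
    by (induction rule: valid_code_induct) (auto simp: length_code_word)
  then show "codes k n \<subseteq> {cs. set cs \<subseteq> {..<k} \<times> {..<k} \<and> length cs = n}"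
    by (auto simp: codes_def)
qed (simp add: finite_lists_length_eq)

lemma finite_flagged_codes: "finite (flagged_codes k ts)"
  by (rule finite_subset[OF _ finite_codes[of k "length ts"]])
    (auto simp: flagged_codes_def codes_def)

text \<open>Codes broken off within a phase, just before its merge.\<close>

definition half_codes :: "nat \<Rightarrow> bool \<Rightarrow> bool list \<Rightarrow> (nat \<times> (nat \<times> nat) list) set" where
  "half_codes k t ts = {(x, cs). x < k - length ts \<and> (x = 0 \<longleftrightarrow> t) \<and> cs \<in> flagged_codes k ts \<and>
     hd (merge_pattern k (x, cs))}"

lemma length_code_word_flagged: "cs \<in> flagged_codes k ts \<Longrightarrow> length (code_word k cs) = k - length ts"
  by (auto simp: flagged_codes_def length_code_word)

lemma finite_half_codes: "finite (half_codes k t ts)"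
  by (rule finite_subset[of _ "{..<k - length ts} \<times> flagged_codes k ts"])
    (auto simp: half_codes_def finite_flagged_codes)

lemma Cons_mem_flagged_codes_iff:
  "(x, y) # cs \<in> flagged_codes k (t # ts) \<longleftrightarrow> (x, cs) \<in> half_codes k t ts \<and> Suc y < k - length ts"
  using length_code_word_flagged[of cs k ts] unfolding flagged_codes_def half_codes_def
  by (auto simp: valid_code_Cons_iff simp del: valid_code.simps)

lemma card_half_codes_fibre:
  assumes "length q = k - length ts" "hd q" "q \<noteq> []"
    and "\<And>r. length r = k - length ts \<Longrightarrow>
      card {cs \<in> flagged_codes k ts. occupied (code_word k cs) = r} = v (count_list r True)"
  shows "card {h \<in> half_codes k t ts. merge_pattern k h = q} = even_step t v (count_list q True)"
proof -
  have "{h \<in> half_codes k t ts. merge_pattern k h = q} = {(x, cs). x < length q \<and> (x = 0 \<longleftrightarrow> t) \<and>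
      cs \<in> flagged_codes k ts \<and> rotate x (True # tl (occupied (code_word k cs))) = q}"
    using assms(1,2) by (auto simp: half_codes_def merge_pattern_def)
  also have "card \<dots> = even_step t v (count_list q True)"
    using assms
    by (intro card_fibre_add_column finite_flagged_codes) (simp_all add: length_code_word_flagged)
  finally show ?thesis .
qed

lemma flagged_codes_Cons_fibre:
  "{cs \<in> flagged_codes k (t # ts). occupied (code_word k cs) = b} =
    (\<lambda>(y, x, cs). (x, y) # cs) ` {(y, h). Suc y < k - length ts \<and> h \<in> half_codes k t ts \<and>
       rotate y (True # tl (tl (merge_pattern k h))) = b}"
    (is "?L = ?f ` ?R")
proof (intro equalityI subsetI)
  fix cs'
  assume cs'_mem: "cs' \<in> ?L"
  then obtain x y cs where cs'_eq: "cs' = (x, y) # cs"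
    by (auto simp: flagged_codes_def)
  have "valid_code k ((x, y) # cs)"
    using cs'_mem by (simp add: cs'_eq flagged_codes_def)
  then have "(y, x, cs) \<in> ?R"
    using cs'_mem occupied_code_word_Cons[of k x y cs] Cons_mem_flagged_codes_iff
    by (simp add: cs'_eq del: code_word.simps)
  then show "cs' \<in> ?f ` ?R"
    by (rule rev_image_eqI) (simp add: cs'_eq)
next
  fix cs'
  assume "cs' \<in> ?f ` ?R"
  then obtain x y cs where cs'_eq: "cs' = (x, y) # cs" "(y, x, cs) \<in> ?R"
    by auto
  then have flagged: "(x, y) # cs \<in> flagged_codes k (t # ts)"
    by (simp add: Cons_mem_flagged_codes_iff)
  then have "valid_code k ((x, y) # cs)"
    by (simp add: flagged_codes_def)
  with flagged show "cs' \<in> ?L"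
    using cs'_eq occupied_code_word_Cons[of k x y cs] by (simp del: code_word.simps)
qed

lemma card_flagged_codes_fibre:
  "length ts < k \<Longrightarrow> length b = k - length ts \<Longrightarrow>
     card {cs \<in> flagged_codes k ts. occupied (code_word k cs) = b} =
     refined_count ts (count_list b True)"
proof (induction ts arbitrary: b)
  case Nil
  have "count_list b True = 0 \<longleftrightarrow> replicate k False = b"
    using Nil.prems(2) unfolding count_list_0_iff
    by (metis (full_types) diff_zero in_set_replicate list.size(3) replicate_eqI)
  moreover have "{cs \<in> flagged_codes k []. occupied (code_word k cs) = b} =
      (if replicate k False = b then {[]} else {})"
    by (auto simp: flagged_codes_def occupied_def)
  ultimately show ?case
    by simp
next
  case (Cons t ts)
  have lengths: "k - length ts = Suc (length b)" "b \<noteq> []"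
    using Cons.prems by auto
  have "inj (\<lambda>(y, x, cs). (x :: nat, y :: nat) # cs)"
    by (auto simp: inj_def)
  then have "card {cs \<in> flagged_codes k (t # ts). occupied (code_word k cs) = b} =
      card {(y, h). y < length b \<and> h \<in> half_codes k t ts \<and>
        rotate y (True # tl (tl (merge_pattern k h))) = b}"
    by (simp add: flagged_codes_Cons_fibre lengths card_image inj_on_subset)
  also have "\<dots> = odd_step (even_step t (refined_count ts)) (count_list b True)"
  proof (rule card_fibre_merge[OF finite_half_codes])
    show "card {h \<in> half_codes k t ts. merge_pattern k h = r} =
        even_step t (refined_count ts) (count_list r True)"
      if "length r = Suc (length b)" "hd r" for r
      using that Cons.prems(1) lengths by (intro card_half_codes_fibre Cons.IH) auto
  qed (use lengths in \<open>auto simp: half_codes_def merge_pattern_def length_code_word_flagged\<close>)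
  finally show ?case
    by simp
qed

lemma fst_last_valid_code: "valid_code k cs \<Longrightarrow> cs \<noteq> [] \<Longrightarrow> fst (last cs) = 0"
proof (induction rule: valid_code_induct)
  case (Cons x y cs)
  show ?case
  proof (cases "cs = []")
    case True
    have "0 < incr_hd (replicate k 0) ! x" "x < k"
      using Cons.hyps(1) by (simp_all add: True)
    then show ?thesis
      by (cases k; cases x) (auto simp: True)
  qed (use Cons in simp)
qed simp

lemma map_fst_eq_0_iff:
  assumes "cs \<in> codes k (Suc n)"
  shows "map (\<lambda>c. fst c = 0) cs = map t [1..<Suc n] @ [True] \<longleftrightarrow>
    (\<forall>i\<in>{1..<Suc n}. fst (cs ! (i - 1)) = 0 \<longleftrightarrow> t i)"
proof -
  have valid: "valid_code k cs" "length cs = Suc n"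
    using assms by (simp_all add: codes_def)
  then have "fst (cs ! n) = 0"
    using fst_last_valid_code[OF valid(1)] by (cases "cs = []") (auto simp: last_conv_nth)
  moreover have shift: "map t [1..<Suc n] = map (t \<circ> Suc) [0..<n]"
    by (simp flip: map_Suc_upt del: upt_Suc)
  ultimately have "map (\<lambda>c. fst c = 0) cs = map t [1..<Suc n] @ [True] \<longleftrightarrow>
      (\<forall>i<n. fst (cs ! i) = 0 \<longleftrightarrow> t (Suc i))"
    using valid(2) unfolding shift by (simp add: list_eq_iff_nth_eq nth_append All_less_Suc)
  also have "\<dots> \<longleftrightarrow> (\<forall>i\<in>Suc ` {..<n}. fst (cs ! (i - 1)) = 0 \<longleftrightarrow> t i)"
    by auto
  finally show ?thesis
    by (simp add: image_Suc_lessThan atLeastLessThanSuc_atLeastAtMost)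
qed

lemma flagged_codes_eq_free_sites:
  assumes "2 \<le> k"
  shows "flagged_codes k (map t [1..<k - 1] @ [True]) =
    {cs \<in> codes k (k - 1). \<forall>i\<in>{1..<k - 1}. free_site k (code_shape k cs) i \<longleftrightarrow> t i}"
proof (rule set_eqI)
  fix cs
  have k_eq: "k - 1 = Suc (k - 2)"
    using assms by simp
  have "map (\<lambda>c. fst c = 0) cs = map t [1..<k - 1] @ [True] \<longleftrightarrow>
      (\<forall>i\<in>{1..<k - 1}. free_site k (code_shape k cs) i \<longleftrightarrow> t i)" if "cs \<in> codes k (k - 1)"
    using map_fst_eq_0_iff[of cs k "k - 2" t, folded k_eq] free_site_code_shape[OF that] that
    by simp
  moreover have "cs \<in> codes k (k - 1)" if "cs \<in> flagged_codes k (map t [1..<k - 1] @ [True])"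
    using that length_flagged_codes[OF that] k_eq by (simp add: codes_def flagged_codes_def)
  ultimately show "cs \<in> flagged_codes k (map t [1..<k - 1] @ [True]) \<longleftrightarrow>
      cs \<in> {cs \<in> codes k (k - 1). \<forall>i\<in>{1..<k - 1}. free_site k (code_shape k cs) i \<longleftrightarrow> t i}"
    by (auto simp: flagged_codes_def codes_def)
qed

lemma occupied_code_word_final:
  assumes "cs \<in> codes k (k - 1)" "2 \<le> k"
  shows "occupied (code_word k cs) = [True]"
proof -
  have "length (code_word k cs) = 1" "sum_list (code_word k cs) = k - 1"
    using assms by (simp_all add: codes_def length_code_word sum_list_code_word)
  then show ?thesis
    using assms(2) by (auto simp: length_Suc_conv occupied_def)
qed

lemma card_irreducible_k_shapes:
  assumes "2 \<le> k"
  shows "card {l \<in> irreducible_k_shapes k. \<forall>i\<in>{1..<k - 1}. free_site k l i \<longleftrightarrow> t i} =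
    refined_count (map t [1..<k - 1] @ [True]) 1"
proof -
  let ?ts = "map t [1..<k - 1] @ [True]"
  have "bij_betw (code_shape k) (flagged_codes k ?ts)
      {l \<in> irreducible_k_shapes k. \<forall>i\<in>{1..<k - 1}. free_site k l i \<longleftrightarrow> t i}"
    unfolding flagged_codes_eq_free_sites[OF assms]
    using bij_betw_code_shape[of k] assms by (intro bij_betw_Collect) auto
  then have "card {l \<in> irreducible_k_shapes k. \<forall>i\<in>{1..<k - 1}. free_site k l i \<longleftrightarrow> t i} =
      card (flagged_codes k ?ts)"
    by (simp add: bij_betw_same_card)
  also have "flagged_codes k ?ts = {cs \<in> flagged_codes k ?ts. occupied (code_word k cs) = [True]}"
    using occupied_code_word_final[OF _ assms] flagged_codes_eq_free_sites[OF assms] by auto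
  also have "card \<dots> = refined_count ?ts 1"
    using card_flagged_codes_fibre[of ?ts k "[True]"] assms by simp
  finally show ?thesis .
qed

section \<open>The bijection\<close>

lemma finite_surj_pistols: "finite (surj_pistols n)"
  by (rule finite_subset[of _ "{1..2*n} \<rightarrow>\<^sub>E (\<lambda>i. 2*i) ` {1..n}"])
    (auto simp: surj_pistols_def intro!: finite_PiE)

lemma finite_irreducible_k_shapes: "0 < k \<Longrightarrow> finite (irreducible_k_shapes k)"
  using bij_betw_finite[OF bij_betw_code_shape] finite_codes by blast

lemma card_fix_vec_fibre_eq_card_fr_vec_fibre:
  assumes "2 \<le> k"
  shows "card {f \<in> surj_pistols (k - 1). fix_vec k f = T} =
    card {l \<in> irreducible_k_shapes k. fr_vec k l = T}"
proof (cases "\<exists>t. T = map (\<lambda>i. if t i then 1 else 0) [1..<k - 1]")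
  case True
  then obtain t where T_eq: "T = map (\<lambda>i. if t i then 1 else 0) [1..<k - 1]"
    by blast
  have "fix_vec k f = T \<longleftrightarrow> (\<forall>i\<in>{1..<k - 1}. f (2*i) = 2*i \<longleftrightarrow> t i)" for f
    by (auto simp: fix_vec_def T_eq)
  moreover have "fr_vec k l = T \<longleftrightarrow> (\<forall>i\<in>{1..<k - 1}. free_site k l i \<longleftrightarrow> t i)" for l
    by (auto simp: fr_vec_def T_eq)
  ultimately show ?thesis
    using card_surj_pistols[of "k - 1" t] card_irreducible_k_shapes[OF assms, of t] assms by simp
next
  case False
  then have "fix_vec k f \<noteq> T" "fr_vec k l \<noteq> T" for f l
    by (auto simp: fix_vec_def fr_vec_def)
  then show ?thesis
    by simp
qed

theorem theorem2:
  fixes k :: nat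
  assumes "k \<ge> 3"
  shows "\<exists>\<phi>. bij_betw \<phi> (surj_pistols (k - 1)) (irreducible_k_shapes k) \<and>
             (\<forall>f\<in>surj_pistols (k - 1). fr_vec k (\<phi> f) = fix_vec k f)"
proof (rule ex_bij_betw_fibres)
  show "finite (surj_pistols (k - 1))"
    by (rule finite_surj_pistols)
  show "finite (irreducible_k_shapes k)"
    using assms by (intro finite_irreducible_k_shapes) simp
  show "card {f \<in> surj_pistols (k - 1). fix_vec k f = T} =
      card {l \<in> irreducible_k_shapes k. fr_vec k l = T}" for T
    using assms by (intro card_fix_vec_fibre_eq_card_fr_vec_fibre) simp
qed

end
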